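(* Let $\hbar>0$ and let $f\in L^2(\mathbb{R})$ be such that the nodal set $\mathcal{N}(Wf)=\{z\in\mathbb{R}^2:Wf(z)=0\}$ is bounded. Then $\mathcal{N}(Wf)$ does not contain any (nondegenerate) line segment.
   Context: $Wf(x,p)=\frac{1}{2\pi\hbar}\int_{\mathbb{R}} f(x+\tau/2)\overline{f(x-\tau/2)}e^{-\frac{i}{\hbar}p\tau}\,d\tau$ for $(x,p)\in\mathbb{R}^2$. *)

theory Defs
  imports "HOL-Analysis.Analysis"
begin

definition L2_real :: "(real \<Rightarrow> complex) \<Rightarrow> bool" where
  "L2_real f \<longleftrightarrow> f \<in> borel_measurable lborel \<and> integrable lborel (\<lambda>x. (norm (f x))\<^sup>2)"

definition wigner :: "real \<Rightarrow> (real \<Rightarrow> complex) \<Rightarrow> real \<Rightarrow> real \<Rightarrow> complex" where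
  "wigner hb f x p = complex_of_real (1 / (2 * pi * hb)) *
     (LINT t|lborel. f (x + t / 2) * cnj (f (x - t / 2)) * exp (- (\<i> * complex_of_real (p * t / hb))))"

definition nodal_set :: "real \<Rightarrow> (real \<Rightarrow> complex) \<Rightarrow> (real \<times> real) set" where
  "nodal_set hb f = {z. wigner hb f (fst z) (snd z) = 0}"

end

theory Submission
  imports Defs
    "HOL-Probability.Probability"
    "HOL-Complex_Analysis.Complex_Analysis"
    "HOL-Computational_Algebra.Fundamental_Theorem_Algebra"
    "HOL-Real_Asymp.Real_Asymp"
begin

text \<open>
  The Wigner transform of an \<open>L\<^sup>2\<close> function is real and continuous, so if its zeros form a bounded set
  it has a constant sign near infinity. Averaging it against a Gaussian centred at a point \<open>(x, p)\<close> gives,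
  up to a nonvanishing factor, the squared modulus of an entire function of Bargmann type at \<open>x - \<i>p\<close>;
  for a centre far away the constant sign wins and the average cannot vanish. The entire function therefore
  has finitely many zeros, and having order at most two it is a polynomial times the exponential of a
  quadratic. Fourier injectivity then shows that \<open>f\<close> is a polynomial times a Gaussian, whose Wigner
  transform is the restriction of an entire function on every line. A zero segment would force a whole line
  of zeros.
\<close>

section \<open>Continuity of translations\<close>

text \<open>The Gaussian average is a squared modulus because the weight
  \<open>exp (- (x - x0)\<^sup>2 - (p - p0)\<^sup>2)\<close> is, up to a factor, itself the Wigner
  transform of a coherent state; the average is the Husimi function of \<open>f\<close>. This fixes
  the widths of the Gaussian once the Planck constant has been scaled to 1. The growth bound alone
  leaves an exponent \<open>\<alpha> * z\<^sup>2 + \<beta> * z\<close> with unknown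
  \<open>\<alpha>\<close>, while inverting the transform needs \<open>Re \<alpha> > 0\<close>. What
  helps is that the transform does not grow along vertical lines. This excludes a negative real part
  and a nonzero imaginary \<open>\<alpha>\<close>; \<open>\<alpha> = 0\<close> would make
  \<open>f\<close> vanish almost everywhere. The quadratic coefficient of \<open>f\<close> is then
  \<open>1 / (4 * \<alpha>) - 1 / 2\<close> up to sign, whose real part may still be of either sign;
  square integrability settles it. Since \<open>f\<close> is merely measurable, continuity of its
  Wigner transform in \<open>x\<close> has no pointwise source and rests on the continuity of
  translations in L^2.\<close>

lemma tendsto_0_if_approx:
  fixes F :: "real \<Rightarrow> real"
  assumes "\<And>e. e > 0 \<Longrightarrow> \<exists>G. (G \<longlongrightarrow> 0) A \<and> (\<forall>h. 0 \<le> F h \<and> F h \<le> G h + e)"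
  shows "(F \<longlongrightarrow> 0) A"
proof (rule tendstoI)
  fix e :: real assume "e > 0"
  then obtain G where G: "(G \<longlongrightarrow> 0) A" "\<And>h. 0 \<le> F h" "\<And>h. F h \<le> G h + e/2"
    using assms[of "e/2"] by auto
  from G(1) \<open>e > 0\<close> have "\<forall>\<^sub>F h in A. dist (G h) 0 < e/2"
    by (intro tendstoD) auto
  then show "\<forall>\<^sub>F h in A. dist (F h) 0 < e"
  proof eventually_elim
    case (elim h)
    then show ?case using G(2,3)[of h] by (simp add: dist_real_def)
  qed
qed

lemma integrable_translate:
  fixes f :: "real \<Rightarrow> 'b::{banach, second_countable_topology}"
  assumes "integrable lborel f"
  shows "integrable lborel (\<lambda>x. f (x + h))"
  using lborel_integrable_real_affine[OF assms, of 1 h] by (simp add: add.commute)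

lemma integral_translate:
  fixes f :: "real \<Rightarrow> 'b::{banach, second_countable_topology}"
  shows "(LINT x|lborel. f (x + h)) = (LINT x|lborel. f x)"
  using lborel_integral_real_affine[of 1 f h] by (simp add: add.commute)

lemma translation_L1_approx:
  fixes f g :: "real \<Rightarrow> 'b::{banach, second_countable_topology}"
  assumes f: "integrable lborel f" and g: "integrable lborel g"
  shows "(LINT x|lborel. norm (f (x + h) - f x)) \<le>
     (LINT x|lborel. norm (g (x + h) - g x)) + 2 * (LINT x|lborel. norm (f x - g x))"
proof -
  have i: "integrable lborel (\<lambda>x. norm (f x - g x))" using f g by auto
  have ih: "integrable lborel (\<lambda>x. norm (f (x+h) - g (x+h)))"
    using integrable_translate[OF i] by simp
  have ig: "integrable lborel (\<lambda>x. norm (g (x+h) - g x))"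
    using integrable_translate[OF g] g by auto
  have "(LINT x|lborel. norm (f (x + h) - f x)) \<le>
    (LINT x|lborel. norm (g (x+h) - g x) + (norm (f (x+h) - g (x+h)) + norm (f x - g x)))"
  proof (rule integral_mono)
    show "integrable lborel (\<lambda>x. norm (f (x + h) - f x))"
      using integrable_translate[OF f] f by auto
    show "integrable lborel (\<lambda>x. norm (g (x+h) - g x) + (norm (f (x+h) - g (x+h)) + norm (f x - g x)))"
      using i ih ig by auto
    fix x
    have "f (x+h) - f x = (g (x+h) - g x) + ((f (x+h) - g (x+h)) - (f x - g x))" by simp
    also have "norm \<dots> \<le> norm (g (x+h) - g x) + norm ((f (x+h) - g (x+h)) - (f x - g x))"
      by (rule norm_triangle_ineq)
    also have "\<dots> \<le> norm (g (x+h) - g x) + (norm (f (x+h) - g (x+h)) + norm (f x - g x))"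
      by (intro add_left_mono norm_triangle_ineq4)
    finally show "norm (f (x + h) - f x) \<le> norm (g (x+h) - g x) + (norm (f (x+h) - g (x+h)) + norm (f x - g x))" .
  qed
  also have "\<dots> = (LINT x|lborel. norm (g (x + h) - g x)) + 2 * (LINT x|lborel. norm (f x - g x))"
    using i ih ig integral_translate[of "\<lambda>x. norm (f x - g x)" h] by simp
  finally show ?thesis .
qed

text \<open>The integral is \<open>norm c\<close> times twice the measure of \<open>U\<close> minus
  twice the overlap of \<open>U\<close> with its translate, so only the overlap has to converge. Its
  integrand needs a limit only at points of \<open>U\<close>, where openness keeps
  \<open>x + h\<close> in \<open>U\<close> for small \<open>h\<close>; the boundary of
  \<open>U\<close>, which may have positive measure, never enters.\<close>

lemma translation_L1_open:
  fixes U :: "real set" and c :: "'b::{banach, second_countable_topology}"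
  assumes U: "open U" "emeasure lborel U < \<infinity>"
  shows "((\<lambda>h. LINT x|lborel. norm (indicator U (x + h) *\<^sub>R c - indicator U x *\<^sub>R c)) \<longlongrightarrow> 0) (at 0)"
proof -
  have [measurable]: "U \<in> sets borel" using U by auto
  have iU: "integrable lborel (indicator U :: real \<Rightarrow> real)"
    using U by (simp add: integrable_indicator_iff)
  have iU': "integrable lborel (\<lambda>x. indicator U (x + h) :: real)" for h
    using integrable_translate[OF iU] .
  let ?J = "\<lambda>h. LINT x|lborel. (indicator U x * indicator U (x + h) :: real)"
  have ij: "integrable lborel (\<lambda>x. indicator U x * indicator U (x + h) :: real)" for h
    by (rule Bochner_Integration.integrable_bound[OF iU]) (auto split: split_indicator)
  have eq: "(LINT x|lborel. norm (indicator U (x + h) *\<^sub>R c - indicator U x *\<^sub>R c))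
     = norm c * (2 * (LINT x|lborel. indicator U x) - 2 * ?J h)" for h
  proof -
    have "(LINT x|lborel. norm (indicator U (x + h) *\<^sub>R c - indicator U x *\<^sub>R c))
      = (LINT x|lborel. norm c * ((indicator U (x + h) + indicator U x) - 2 * (indicator U x * indicator U (x + h))))"
      by (rule Bochner_Integration.integral_cong) (auto split: split_indicator)
    also have "\<dots> = norm c * (((LINT x|lborel. indicator U (x + h)) + (LINT x|lborel. indicator U x)) - 2 * ?J h)"
      using iU iU'[of h] ij[of h] by simp
    finally show ?thesis by (simp add: integral_translate)
  qed
  have "(?J \<longlongrightarrow> (LINT x|lborel. indicator U x)) (at 0)"
  proof (rule tendsto_at_iff_sequentially[THEN iffD2], intro allI impI)
    fix X :: "nat \<Rightarrow> real" assume X: "\<forall>i. X i \<in> UNIV - {0}" "X \<longlonglongrightarrow> 0"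
    have "(\<lambda>i. ?J (X i)) \<longlonglongrightarrow> (LINT x|lborel. indicator U x)"
    proof (rule integral_dominated_convergence[where w="indicator U"])
      show "AE x in lborel. (\<lambda>i. indicator U x * indicator U (x + X i) :: real) \<longlonglongrightarrow> indicator U x"
      proof (rule AE_I2)
        fix x
        show "(\<lambda>i. indicator U x * indicator U (x + X i) :: real) \<longlonglongrightarrow> indicator U x"
        proof (cases "x \<in> U")
          case True
          have "(\<lambda>i. x + X i) \<longlonglongrightarrow> x + 0" by (intro tendsto_intros X)
          then have "\<forall>\<^sub>F i in sequentially. x + X i \<in> U"
            using True U by (intro topological_tendstoD) auto
          then have "\<forall>\<^sub>F i in sequentially. (indicator U x * indicator U (x + X i) :: real) = 1"
            by eventually_elim (use True in auto)
          then show ?thesis using True by (simp add: tendsto_eventually)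
        qed auto
      qed
    qed (use iU in \<open>auto split: split_indicator\<close>)
    then show "(?J \<circ> X) \<longlonglongrightarrow> (LINT x|lborel. indicator U x)" by (simp add: o_def)
  qed
  then have "((\<lambda>h. norm c * (2 * (LINT x|lborel. indicator U x) - 2 * ?J h)) \<longlongrightarrow>
     norm c * (2 * (LINT x|lborel. indicator U x) - 2 * (LINT x|lborel. indicator U x))) (at 0)"
    by (intro tendsto_intros)
  then show ?thesis unfolding eq by simp
qed

text \<open>Outer regularity reduces an indicator to that of an open set. The property then passes
  to sums by the triangle inequality and to limits of simple functions, because the approximation
  error in \<open>translation_L1_approx\<close> is the same for all \<open>h\<close>.\<close>

lemma translation_continuous_L1:
  fixes f :: "real \<Rightarrow> 'b::{banach, second_countable_topology}"
  assumes "integrable lborel f"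
  shows "((\<lambda>h. LINT x|lborel. norm (f (x + h) - f x)) \<longlongrightarrow> 0) (at 0)"
  using assms
proof (induction rule: integrable_induct)
  case (base A c)
  have A: "A \<in> sets borel" using base by simp
  have iA: "integrable lborel (\<lambda>x. indicator A x *\<^sub>R c)"
    using base by (simp add: integrable_indicator_iff)
  show ?case
  proof (rule tendsto_0_if_approx)
    fix e :: real assume e: "e > 0"
    define d where "d = e / (2 * (norm c + 1))"
    have d: "d > 0" using e by (simp add: d_def add_nonneg_pos)
    obtain U where U: "open U" "A \<subseteq> U" "U - A \<in> lmeasurable" "emeasure lebesgue (U - A) < ennreal d"
      using sets_lebesgue_outer_open[of A d] A d by auto
    have mU[measurable]: "U \<in> sets borel" "A \<in> sets borel" using U A by auto
    have UA: "emeasure lborel (U - A) < ennreal d" using U(4) by simp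
    have "emeasure lborel U \<le> emeasure lborel A + emeasure lborel (U - A)"
      using emeasure_subadditive[of A lborel "U - A"] U(2) by (simp add: Un_absorb1)
    also have "\<dots> < \<infinity>" using base(2) UA by (simp add: less_top order.strict_trans2)
    finally have fU: "emeasure lborel U < \<infinity>" .
    have iU: "integrable lborel (\<lambda>x. indicator U x *\<^sub>R c)"
      using fU by (simp add: integrable_indicator_iff)
    have "(LINT x|lborel. norm (indicator A x *\<^sub>R c - indicator U x *\<^sub>R c)) = (LINT x|lborel. norm c * indicator (U - A) x)"
      by (rule Bochner_Integration.integral_cong) (use U(2) in \<open>auto split: split_indicator\<close>)
    also have "\<dots> = norm c * measure lborel (U - A)" by simp
    also have "\<dots> \<le> norm c * d"
      using UA d by (intro mult_left_mono) (auto simp: measure_def intro!: enn2real_leI)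
    also have "2 * (norm c * d) \<le> e"
    proof -
      have "norm c + 1 > 0" by (simp add: add_nonneg_pos)
      then have "2 * (norm c * d) = e * (norm c / (norm c + 1))" by (simp add: d_def divide_simps)
      also have "\<dots> \<le> e * 1" using e by (intro mult_left_mono) (auto simp: divide_simps add_nonneg_pos)
      finally show ?thesis by simp
    qed
    finally have "2 * (LINT x|lborel. norm (indicator A x *\<^sub>R c - indicator U x *\<^sub>R c)) \<le> e" by simp
    then show "\<exists>G. (G \<longlongrightarrow> 0) (at 0) \<and> (\<forall>h. 0 \<le> (LINT x|lborel. norm (indicator A (x + h) *\<^sub>R c - indicator A x *\<^sub>R c)) \<and>
        (LINT x|lborel. norm (indicator A (x + h) *\<^sub>R c - indicator A x *\<^sub>R c)) \<le> G h + e)"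
      by (intro exI[of _ "\<lambda>h. LINT x|lborel. norm (indicator U (x + h) *\<^sub>R c - indicator U x *\<^sub>R c)"]
            conjI allI translation_L1_open[OF U(1) fU, of c]
            order_trans[OF translation_L1_approx[OF iA iU]] add_left_mono) simp_all
  qed
next
  case (add f g)
  note if' = integrable_translate[OF add.hyps(1)] and ig' = integrable_translate[OF add.hyps(2)]
  let ?G = "\<lambda>h. (LINT x|lborel. norm (f (x + h) - f x)) + (LINT x|lborel. norm (g (x + h) - g x))"
  have "(LINT x|lborel. norm (f (x + h) + g (x + h) - (f x + g x))) \<le> ?G h" for h
  proof -
    have "(LINT x|lborel. norm (f (x + h) + g (x + h) - (f x + g x))) \<le>
      (LINT x|lborel. norm (f (x + h) - f x) + norm (g (x + h) - g x))"
    proof (rule integral_mono)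
      show "integrable lborel (\<lambda>x. norm (f (x + h) + g (x + h) - (f x + g x)))"
        by (intro integrable_norm Bochner_Integration.integrable_diff Bochner_Integration.integrable_add add.hyps if' ig')
      show "integrable lborel (\<lambda>x. norm (f (x + h) - f x) + norm (g (x + h) - g x))"
        by (intro integrable_norm Bochner_Integration.integrable_diff Bochner_Integration.integrable_add add.hyps if' ig')
    qed (rule norm_diff_triangle_ineq)
    also have "\<dots> = ?G h"
      by (intro Bochner_Integration.integral_add integrable_norm Bochner_Integration.integrable_diff add.hyps if' ig')
    finally show ?thesis .
  qed
  then have le: "\<forall>\<^sub>F h in at 0. (LINT x|lborel. norm (f (x + h) + g (x + h) - (f x + g x))) \<le> ?G h"
    by (intro always_eventually allI)
  have ge: "\<forall>\<^sub>F h in at 0. 0 \<le> (LINT x|lborel. norm (f (x + h) + g (x + h) - (f x + g x)))"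
    by (intro always_eventually allI Bochner_Integration.integral_nonneg norm_ge_zero)
  show ?case
    by (rule tendsto_sandwich[OF ge le tendsto_const]) (use tendsto_add[OF add.IH] in simp)
next
  case (lim f s)
  have mf[measurable]: "f \<in> borel_measurable lborel" "s i \<in> borel_measurable lborel" for i
    using lim.hyps(1,4) by auto
  have "(\<lambda>i. LINT x|lborel. norm (f x - s i x)) \<longlonglongrightarrow> (LINT x::real|lborel. (0::real))"
  proof (rule integral_dominated_convergence[where w="\<lambda>x. 3 * norm (f x)"])
    show "AE x in lborel. (\<lambda>i. norm (f x - s i x)) \<longlonglongrightarrow> 0"
    proof (rule AE_I2)
      fix x
      have "(\<lambda>i. norm (f x - s i x)) \<longlonglongrightarrow> norm (f x - f x)"
        using lim.hyps(2)[of x] by (intro tendsto_intros) simp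
      then show "(\<lambda>i. norm (f x - s i x)) \<longlonglongrightarrow> 0" by simp
    qed
    fix i show "AE x in lborel. norm (norm (f x - s i x)) \<le> 3 * norm (f x)"
    proof (rule AE_I2)
      fix x
      show "norm (norm (f x - s i x)) \<le> 3 * norm (f x)"
        using lim.hyps(3)[of x i] norm_triangle_ineq4[of "f x" "s i x"] by simp
    qed
  qed (use lim.hyps(4) in auto)
  then have L: "(\<lambda>i. LINT x|lborel. norm (f x - s i x)) \<longlonglongrightarrow> 0" by simp
  show ?case
  proof (rule tendsto_0_if_approx)
    fix e :: real assume e: "e > 0"
    then have "\<forall>\<^sub>F i in sequentially. (LINT x|lborel. norm (f x - s i x)) < e/2"
      using order_tendstoD(2)[OF L, of "e/2"] by simp
    then obtain i where i: "(LINT x|lborel. norm (f x - s i x)) < e/2"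
      by (auto simp: eventually_sequentially)
    show "\<exists>G. (G \<longlongrightarrow> 0) (at 0) \<and> (\<forall>h. 0 \<le> (LINT x|lborel. norm (f (x + h) - f x)) \<and>
        (LINT x|lborel. norm (f (x + h) - f x)) \<le> G h + e)"
      using i
      by (intro exI[of _ "\<lambda>h. LINT x|lborel. norm (s i (x + h) - s i x)"]
            conjI allI lim.IH order_trans[OF translation_L1_approx[OF lim.hyps(4) lim.hyps(1)[of i]]] add_left_mono) simp_all
  qed
qed

text \<open>Reduces the \<open>L\<^sup>2\<close> continuity of translations of \<open>f\<close> to the \<open>L\<^sup>1\<close> continuity for \<open>|f| f\<close>.\<close>

lemma norm_diff_sq_le_signed_sq:
  fixes a b :: "'a::real_inner"
  shows "(norm (a - b))\<^sup>2 \<le> 2 * norm (norm a *\<^sub>R a - norm b *\<^sub>R b)"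
proof (cases "a = b")
  case False
  then have p: "norm (a - b) > 0" by simp
  \<comment> \<open>Pairing with \<open>a - b\<close> makes the gain visible: the right side is at
    least the cube of \<open>norm (a - b)\<close>, since \<open>norm a + norm b\<close> dominates
    \<open>norm (a - b)\<close>. Cauchy-Schwarz on the left then allows one factor
    \<open>norm (a - b)\<close> to be cancelled.\<close>
  have "2 * ((norm a *\<^sub>R a - norm b *\<^sub>R b) \<bullet> (a - b)) =
     (norm a + norm b) * (norm (a-b))\<^sup>2 + (norm a + norm b) * (norm a - norm b)\<^sup>2"
  proof -
    have "(norm (a-b))\<^sup>2 = (norm a)\<^sup>2 - 2 * (a \<bullet> b) + (norm b)\<^sup>2"
      by (simp add: power2_norm_eq_inner inner_diff inner_commute)
    then show ?thesis
      by (simp add: inner_diff inner_commute dot_square_norm) (simp add: power2_eq_square algebra_simps)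
  qed
  moreover have "(norm a + norm b) * (norm a - norm b)\<^sup>2 \<ge> 0" by simp
  moreover have "norm (a-b) * (norm (a-b))\<^sup>2 \<le> (norm a + norm b) * (norm (a-b))\<^sup>2"
    by (intro mult_right_mono norm_triangle_ineq4) auto
  moreover have "(norm a *\<^sub>R a - norm b *\<^sub>R b) \<bullet> (a - b) \<le> norm (norm a *\<^sub>R a - norm b *\<^sub>R b) * norm (a - b)"
    by (rule norm_cauchy_schwarz)
  ultimately have "norm (a-b) * (norm (a-b))\<^sup>2 \<le> norm (a-b) * (2 * norm (norm a *\<^sub>R a - norm b *\<^sub>R b))"
    unfolding mult.commute[of "norm (a-b)" "2 * _"] mult.assoc by linarith
  then show ?thesis using p by simp
qed simp

section \<open>The Wigner transform of a square-integrable function\<close>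

text \<open>The Wigner transform for Planck constant 1, without its nonzero prefactor. Passing to it
  only rescales the momentum axis, which affects neither boundedness of the zero set nor the
  presence of segments.\<close>

definition unit_wigner :: "(real \<Rightarrow> complex) \<Rightarrow> real \<Rightarrow> real \<Rightarrow> complex" where
  "unit_wigner f x p = (LINT t|lborel. f (x + t / 2) * cnj (f (x - t / 2)) * exp (- (\<i> * complex_of_real (p * t))))"

lemma wigner_eq_unit_wigner: "wigner hb f x p = complex_of_real (1 / (2 * pi * hb)) * unit_wigner f x (p / hb)"
  by (simp add: wigner_def unit_wigner_def)

lemma norm_mult_le_weighted:
  fixes a b :: complex
  assumes "e > 0"
  shows "norm (a * b) \<le> ((norm a)\<^sup>2 / e + e * (norm b)\<^sup>2) / 2"
proof -
  have "0 \<le> (norm a / sqrt e - sqrt e * norm b)\<^sup>2" by simp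
  also have "\<dots> = (norm a)\<^sup>2 / e + e * (norm b)\<^sup>2 - 2 * (norm a * norm b)"
    using assms by (simp add: power2_diff power_divide power_mult_distrib)
  finally show ?thesis by (simp add: norm_mult)
qed

lemma borel_measurable_cnj [measurable]: "cnj \<in> borel_measurable borel"
  by (intro borel_measurable_continuous_onI continuous_intros)

lemma L2_affine:
  assumes "L2_real f" "c \<noteq> 0"
  shows "L2_real (\<lambda>x. f (t + c * x))"
  using assms lborel_integrable_real_affine[of "\<lambda>x. (norm (f x))\<^sup>2" c t]
  by (auto simp: L2_real_def)

lemma L2_cnj: "L2_real f \<Longrightarrow> L2_real (\<lambda>x. cnj (f x))"
  unfolding L2_real_def by auto

lemma L2_mult_integrable:
  assumes "L2_real f" "L2_real g"
  shows "integrable lborel (\<lambda>x. f x * g x)"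
proof (rule Bochner_Integration.integrable_bound)
  show "integrable lborel (\<lambda>x. ((norm (f x))\<^sup>2 + (norm (g x))\<^sup>2) / 2)"
    using assms by (auto simp: L2_real_def)
  show "(\<lambda>x. f x * g x) \<in> borel_measurable lborel"
    using assms by (auto simp: L2_real_def)
  show "AE x in lborel. norm (f x * g x) \<le> norm (((norm (f x))\<^sup>2 + (norm (g x))\<^sup>2) / 2)"
    using norm_mult_le_weighted[of 1 "f _" "g _"] by (intro AE_I2) simp
qed

text \<open>Cauchy-Schwarz in additive form: the free parameter \<open>e\<close> takes the place of
  the square roots of the two integrals, and it can be kept small and fixed while the first integral
  tends to 0.\<close>

lemma L2_mult_norm_integral_le:
  assumes fg: "L2_real f" "L2_real g" and e: "e > 0"
  shows "(LINT x|lborel. norm (f x * g x)) \<le>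
     ((LINT x|lborel. (norm (f x))\<^sup>2) / e + e * (LINT x|lborel. (norm (g x))\<^sup>2)) / 2"
proof -
  have i: "integrable lborel (\<lambda>x. (norm (f x))\<^sup>2)" "integrable lborel (\<lambda>x. (norm (g x))\<^sup>2)"
    using fg by (auto simp: L2_real_def)
  have "(LINT x|lborel. norm (f x * g x)) \<le> (LINT x|lborel. ((norm (f x))\<^sup>2 / e + e * (norm (g x))\<^sup>2) / 2)"
    by (intro integral_mono norm_mult_le_weighted e integrable_norm L2_mult_integrable fg) (use i in auto)
  also have "\<dots> = ((LINT x|lborel. (norm (f x))\<^sup>2) / e + e * (LINT x|lborel. (norm (g x))\<^sup>2)) / 2"
    using i by simp
  finally show ?thesis .
qed

lemma L2_diff:
  assumes "L2_real f" "L2_real g"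
  shows "L2_real (\<lambda>x. f x - g x)"
  unfolding L2_real_def
proof
  show m: "(\<lambda>x. f x - g x) \<in> borel_measurable lborel" using assms by (auto simp: L2_real_def)
  show "integrable lborel (\<lambda>x. (norm (f x - g x))\<^sup>2)"
  proof (rule Bochner_Integration.integrable_bound)
    show "integrable lborel (\<lambda>x. 2 * (norm (f x))\<^sup>2 + 2 * (norm (g x))\<^sup>2)"
      using assms by (auto simp: L2_real_def)
    show "(\<lambda>x. (norm (f x - g x))\<^sup>2) \<in> borel_measurable lborel" using m by simp
    show "AE x in lborel. norm ((norm (f x - g x))\<^sup>2) \<le> norm (2 * (norm (f x))\<^sup>2 + 2 * (norm (g x))\<^sup>2)"
    proof (rule AE_I2)
      fix x
      have "(norm (f x - g x))\<^sup>2 \<le> (norm (f x) + norm (g x))\<^sup>2"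
        by (intro power_mono norm_triangle_ineq4) auto
      also have "\<dots> \<le> 2 * (norm (f x))\<^sup>2 + 2 * (norm (g x))\<^sup>2"
        using sum_squares_bound[of "norm (f x)" "norm (g x)"] by (simp add: power2_sum)
      finally show "norm ((norm (f x - g x))\<^sup>2) \<le> norm (2 * (norm (f x))\<^sup>2 + 2 * (norm (g x))\<^sup>2)" by simp
    qed
  qed
qed

lemma translation_continuous_L2:
  fixes f :: "real \<Rightarrow> complex"
  assumes f: "L2_real f"
  shows "((\<lambda>h. LINT x|lborel. (norm (f (x + h) - f x))\<^sup>2) \<longlongrightarrow> 0) (at 0)"
proof -
  have fm[measurable]: "f \<in> borel_measurable borel" using f by (simp add: L2_real_def)
  let ?g = "\<lambda>x. norm (f x) *\<^sub>R f x"
  have ig: "integrable lborel ?g"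
    by (rule Bochner_Integration.integrable_bound[where f="\<lambda>x. (norm (f x))\<^sup>2"])
       (use f in \<open>auto simp: L2_real_def power2_eq_square\<close>)
  let ?T = "\<lambda>h. LINT x|lborel. (norm (f (x + h) - f x))\<^sup>2"
  have le: "?T h \<le> 2 * (LINT x|lborel. norm (?g (x + h) - ?g x))" for h
  proof -
    have "?T h \<le> (LINT x|lborel. 2 * norm (?g (x + h) - ?g x))"
    proof (rule integral_mono)
      have "L2_real (\<lambda>x. f (h + 1 * x) - f x)" by (intro L2_diff f L2_affine) simp
      then show "integrable lborel (\<lambda>x. (norm (f (x + h) - f x))\<^sup>2)"
        by (simp add: L2_real_def add.commute)
      show "integrable lborel (\<lambda>x. 2 * norm (?g (x + h) - ?g x))"
        by (intro integrable_mult_right integrable_norm Bochner_Integration.integrable_diff ig integrable_translate[OF ig])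
    qed (rule norm_diff_sq_le_signed_sq)
    then show ?thesis by simp
  qed
  have "((\<lambda>h. 2 * (LINT x|lborel. norm (?g (x + h) - ?g x))) \<longlongrightarrow> 2 * 0) (at 0)"
    by (intro tendsto_intros translation_continuous_L1 ig)
  then have lim: "((\<lambda>h. 2 * (LINT x|lborel. norm (?g (x + h) - ?g x))) \<longlongrightarrow> 0) (at 0)" by simp
  show ?thesis
  proof (rule tendsto_sandwich[OF _ _ tendsto_const lim])
    show "\<forall>\<^sub>F h in at 0. 0 \<le> ?T h" by (intro always_eventually allI Bochner_Integration.integral_nonneg) simp
    show "\<forall>\<^sub>F h in at 0. ?T h \<le> 2 * (LINT x|lborel. norm (?g (x + h) - ?g x))"
      using le by (intro always_eventually allI)
  qed
qed

lemma integral_Fourier_continuous: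
  fixes a :: "real \<Rightarrow> complex"
  assumes a: "integrable lborel a"
  shows "isCont (\<lambda>p. LINT t|lborel. a t * exp (- (\<i> * complex_of_real (p * t)))) p"
  unfolding continuous_at_sequentially
proof (intro allI impI)
  fix X :: "nat \<Rightarrow> real" assume X: "X \<longlonglongrightarrow> p"
  have [measurable]: "a \<in> borel_measurable borel" using a by auto
  have "(\<lambda>n. LINT t|lborel. a t * exp (- (\<i> * complex_of_real (X n * t)))) \<longlonglongrightarrow>
     (LINT t|lborel. a t * exp (- (\<i> * complex_of_real (p * t))))"
  proof (rule integral_dominated_convergence[where w="\<lambda>t. norm (a t)"])
    show "AE t in lborel. (\<lambda>n. a t * exp (- (\<i> * complex_of_real (X n * t)))) \<longlonglongrightarrow> a t * exp (- (\<i> * complex_of_real (p * t)))"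
      by (intro AE_I2 tendsto_intros X)
    fix n show "AE t in lborel. norm (a t * exp (- (\<i> * complex_of_real (X n * t)))) \<le> norm (a t)"
      by (intro AE_I2) (simp add: norm_mult)
  qed (use a in auto)
  then show "((\<lambda>p. LINT t|lborel. a t * exp (- (\<i> * complex_of_real (p * t)))) \<circ> X) \<longlonglongrightarrow>
     (LINT t|lborel. a t * exp (- (\<i> * complex_of_real (p * t))))" by (simp add: o_def)
qed

context
  fixes f :: "real \<Rightarrow> complex"
  assumes f: "L2_real f"
begin

lemma L2_half:
  shows "L2_real (\<lambda>t. f (x + t / 2))" "L2_real (\<lambda>t. f (x - t / 2))" "L2_real (\<lambda>t. cnj (f (x - t / 2)))"
proof -
  show "L2_real (\<lambda>t. f (x + t / 2))" using L2_affine[OF f, of "1/2" x] by simp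
  show "L2_real (\<lambda>t. f (x - t / 2))" using L2_affine[OF f, of "-1/2" x] by simp
  then show "L2_real (\<lambda>t. cnj (f (x - t / 2)))" by (rule L2_cnj)
qed

lemma L2_half_integral:
  shows "(LINT t|lborel. (norm (f (x + t / 2)))\<^sup>2) = 2 * (LINT t|lborel. (norm (f t))\<^sup>2)"
        "(LINT t|lborel. (norm (f (x - t / 2)))\<^sup>2) = 2 * (LINT t|lborel. (norm (f t))\<^sup>2)"
  using lborel_integral_real_affine[of "1/2" "\<lambda>t. (norm (f t))\<^sup>2" x]
        lborel_integral_real_affine[of "-1/2" "\<lambda>t. (norm (f t))\<^sup>2" x] by simp_all

lemma unit_wigner_kernel_integrable: "integrable lborel (\<lambda>t. f (x + t / 2) * cnj (f (x - t / 2)))"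
  by (intro L2_mult_integrable L2_half)

lemma unit_wigner_kernel_norm_le:
  "(LINT t|lborel. norm (f (x + t / 2) * cnj (f (x - t / 2)))) \<le> 2 * (LINT t|lborel. (norm (f t))\<^sup>2)"
  using L2_mult_norm_integral_le[OF L2_half(1)[of x] L2_half(3)[of x], of 1] by (simp add: L2_half_integral)

lemma unit_wigner_integrable:
  "integrable lborel (\<lambda>t. f (x + t / 2) * cnj (f (x - t / 2)) * exp (- (\<i> * complex_of_real (p * t))))"
  by (rule Bochner_Integration.integrable_bound[OF unit_wigner_kernel_integrable[of x]])
     (use f in \<open>auto simp: norm_mult L2_real_def\<close>)

lemma norm_unit_wigner_le: "norm (unit_wigner f x p) \<le> 2 * (LINT t|lborel. (norm (f t))\<^sup>2)"
proof -
  have "norm (unit_wigner f x p) \<le> (LINT t|lborel. norm (f (x + t / 2) * cnj (f (x - t / 2)) * exp (- (\<i> * complex_of_real (p * t)))))"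
    unfolding unit_wigner_def by (rule integral_norm_bound)
  also have "\<dots> = (LINT t|lborel. norm (f (x + t / 2) * cnj (f (x - t / 2))))"
    by (simp add: norm_mult)
  finally show ?thesis using unit_wigner_kernel_norm_le[of x] by linarith
qed

text \<open>Conjugation swaps the two factors of \<open>f\<close> and reverses the phase; the
  substitution of \<open>- t\<close> for \<open>t\<close> undoes both.\<close>

lemma unit_wigner_real: "unit_wigner f x p \<in> \<real>"
proof -
  have "cnj (unit_wigner f x p) = (LINT t|lborel. cnj (f (x + t / 2) * cnj (f (x - t / 2)) * exp (- (\<i> * complex_of_real (p * t)))))"
    unfolding unit_wigner_def by (rule Bochner_Integration.integral_cnj[symmetric])
  also have "\<dots> = (LINT t|lborel. cnj (f (x + (0 + -1 * t) / 2) * cnj (f (x - (0 + -1 * t) / 2)) * exp (- (\<i> * complex_of_real (p * (0 + -1 * t))))))"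
    by (subst lborel_integral_real_affine[of "-1" _ 0]) simp_all
  also have "\<dots> = unit_wigner f x p"
    unfolding unit_wigner_def by (rule Bochner_Integration.integral_cong) (simp_all add: exp_cnj mult.commute)
  finally show ?thesis by (simp add: Reals_cnj_iff)
qed

text \<open>The difference of the two kernels splits into two terms, each carrying one translation
  increment of \<open>f\<close>. The exponential has modulus 1, so \<open>p\<close> drops out of the
  bound.\<close>

lemma unit_wigner_translate_le:
  assumes e: "e > 0"
  shows "norm (unit_wigner f (x + h) p - unit_wigner f x p) \<le>
    2 * ((LINT u|lborel. (norm (f (u + h) - f u))\<^sup>2) / e + e * (LINT t|lborel. (norm (f t))\<^sup>2))"
proof -
  let ?E = "\<lambda>t. exp (- (\<i> * complex_of_real (p * t)))"
  let ?N = "LINT t|lborel. (norm (f t))\<^sup>2"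
  let ?T = "LINT u|lborel. (norm (f (u + h) - f u))\<^sup>2"
  let ?a = "\<lambda>t. f (x + h + t / 2) - f (x + t / 2)"
  let ?b = "\<lambda>t. cnj (f (x + h - t / 2)) - cnj (f (x - t / 2))"
  have nE: "norm (?E t) = 1" for t by simp
  have La: "L2_real ?a" and Lb: "L2_real ?b"
    by (intro L2_diff L2_half)+
  have "?T = \<bar>1/2\<bar> *\<^sub>R (LINT t|lborel. (norm (?a t))\<^sup>2)"
    by (subst lborel_integral_real_affine[of "1/2" _ x]) (simp_all add: algebra_simps)
  then have Ta: "(LINT t|lborel. (norm (?a t))\<^sup>2) = 2 * ?T" by simp
  have nb: "norm (?b t) = norm (f (x + h - t / 2) - f (x - t / 2))" for t
    by (metis complex_cnj_diff complex_mod_cnj)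
  have "?T = \<bar>-1/2\<bar> *\<^sub>R (LINT t|lborel. (norm (?b t))\<^sup>2)"
    unfolding nb by (subst lborel_integral_real_affine[of "-1/2" _ x]) (simp_all add: algebra_simps)
  then have Tb: "(LINT t|lborel. (norm (?b t))\<^sup>2) = 2 * ?T" by simp
  have i1: "integrable lborel (\<lambda>t. ?a t * cnj (f (x + h - t / 2)))"
    by (intro L2_mult_integrable La L2_half)
  have i2: "integrable lborel (\<lambda>t. ?b t * f (x + t / 2))"
    by (intro L2_mult_integrable Lb L2_half)
  have eq: "unit_wigner f (x + h) p - unit_wigner f x p =
     (LINT t|lborel. (?a t * cnj (f (x + h - t / 2)) + ?b t * f (x + t / 2)) * ?E t)"
    unfolding unit_wigner_def
    by (subst Bochner_Integration.integral_diff[symmetric, OF unit_wigner_integrable unit_wigner_integrable])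
       (simp add: algebra_simps)
  have "norm (unit_wigner f (x + h) p - unit_wigner f x p) \<le> (LINT t|lborel. norm ((?a t * cnj (f (x + h - t / 2)) + ?b t * f (x + t / 2)) * ?E t))"
    unfolding eq by (rule integral_norm_bound)
  also have "\<dots> = (LINT t|lborel. norm (?a t * cnj (f (x + h - t / 2)) + ?b t * f (x + t / 2)))"
    by (intro Bochner_Integration.integral_cong refl) (subst norm_mult, subst nE, rule mult_1_right)
  also have "\<dots> \<le> (LINT t|lborel. norm (?a t * cnj (f (x + h - t / 2))) + norm (?b t * f (x + t / 2)))"
    by (intro integral_mono norm_triangle_ineq integrable_norm Bochner_Integration.integrable_add i1 i2)
  also have "\<dots> = (LINT t|lborel. norm (?a t * cnj (f (x + h - t / 2)))) + (LINT t|lborel. norm (?b t * f (x + t / 2)))"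
    by (intro Bochner_Integration.integral_add integrable_norm i1 i2)
  also have "\<dots> \<le> (2 * ?T / e + e * (2 * ?N)) / 2 + (2 * ?T / e + e * (2 * ?N)) / 2"
    using L2_mult_norm_integral_le[OF La L2_half(3)[of "x+h"] e] L2_mult_norm_integral_le[OF Lb L2_half(1)[of x] e]
    unfolding Ta Tb by (intro add_mono) (simp_all add: L2_half_integral)
  finally show ?thesis by simp
qed

text \<open>Moving \<open>x\<close> is controlled uniformly in \<open>p\<close> by
  \<open>unit_wigner_translate_le\<close>, and at fixed \<open>x\<close> the map in \<open>p\<close>
  is the Fourier transform of an integrable function. The uniformity is what turns the two separate
  continuities into a joint one.\<close>

lemma unit_wigner_continuous: "continuous_on UNIV (\<lambda>z. unit_wigner f (fst z) (snd z))"
  unfolding continuous_on_eq_continuous_at[OF open_UNIV]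
proof
  fix z :: "real \<times> real"
  obtain x p where z: "z = (x, p)" by (cases z)
  define N where "N = (LINT t|lborel. (norm (f t))\<^sup>2)"
  let ?T = "\<lambda>h. LINT u|lborel. (norm (f (u + h) - f u))\<^sup>2"
  have N: "N \<ge> 0" by (simp add: N_def)
  have cT: "isCont ?T 0"
    unfolding isCont_def using translation_continuous_L2[OF f] by simp
  have tT: "((\<lambda>w. ?T (fst w - x)) \<longlongrightarrow> ?T 0) (at z)"
    by (rule isCont_tendsto_compose[OF cT]) (auto intro!: tendsto_eq_intros simp: z)
  have 1: "((\<lambda>w. norm (unit_wigner f (fst w) (snd w) - unit_wigner f x (snd w))) \<longlongrightarrow> 0) (at z)"
  proof (rule tendstoI)
    fix e :: real assume e: "e > 0"
    define d where "d = e / (4 * (N + 1))"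
    have d: "d > 0" using e N by (simp add: d_def)
    have "2 * (d * N) \<le> e / 2"
    proof -
      have "2 * (d * N) = e / 2 * (N / (N + 1))" using N by (simp add: d_def divide_simps)
      also have "\<dots> \<le> e / 2 * 1" using e N by (intro mult_left_mono) (auto simp: divide_simps)
      finally show ?thesis by simp
    qed
    note dN = this
    have "\<forall>\<^sub>F w in at z. 2 * (?T (fst w - x) / d) < e / 2"
    proof -
      have "((\<lambda>w. 2 * (?T (fst w - x) / d)) \<longlongrightarrow> 2 * (?T 0 / d)) (at z)"
        by (intro tendsto_intros tT) (use d in simp)
      then show ?thesis by (rule order_tendstoD) (use e in simp)
    qed
    then show "\<forall>\<^sub>F w in at z. dist (norm (unit_wigner f (fst w) (snd w) - unit_wigner f x (snd w))) 0 < e"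
    proof (eventually_elim)
      case (elim w)
      then show ?case
        using dN unit_wigner_translate_le[OF d, of x "fst w - x" "snd w"] by (simp add: distrib_left N_def)
    qed
  qed
  have cp: "isCont (\<lambda>p. unit_wigner f x p) p"
    unfolding unit_wigner_def by (rule integral_Fourier_continuous[OF unit_wigner_kernel_integrable])
  have 2: "((\<lambda>w. unit_wigner f x (snd w)) \<longlongrightarrow> unit_wigner f x p) (at z)"
    by (rule isCont_tendsto_compose[OF cp]) (auto intro!: tendsto_eq_intros simp: z)
  have "((\<lambda>w. (unit_wigner f (fst w) (snd w) - unit_wigner f x (snd w)) + unit_wigner f x (snd w)) \<longlongrightarrow> 0 + unit_wigner f x p) (at z)"
    by (intro tendsto_add 2 tendsto_norm_zero_cancel[OF 1])
  then show "isCont (\<lambda>z. unit_wigner f (fst z) (snd z)) z" by (simp add: isCont_def z)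
qed

end

section \<open>Holomorphic parameter integrals and Fourier injectivity\<close>

text \<open>Domination of \<open>g\<close> alone suffices: Cauchy's inequality bounds the derivative
  on a smaller disc by a multiple of the same \<open>B\<close>, and hence all difference quotients.
  In applications no separate majorant for the derivative has to be found.\<close>

lemma has_field_derivative_integral:
  fixes g g' :: "complex \<Rightarrow> 'a \<Rightarrow> complex"
  assumes r: "r > 0"
    and meas: "\<And>z. z \<in> ball z0 r \<Longrightarrow> g z \<in> borel_measurable M"
    and der: "\<And>z t. z \<in> ball z0 r \<Longrightarrow> ((\<lambda>z. g z t) has_field_derivative g' z t) (at z)"
    and bd: "\<And>z t. z \<in> ball z0 r \<Longrightarrow> norm (g z t) \<le> B t"
    and B: "integrable M B"
  shows "((\<lambda>z. LINT t|M. g z t) has_field_derivative (LINT t|M. g' z0 t)) (at z0)"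
proof -
  have ig: "integrable M (g z)" if "z \<in> ball z0 r" for z
    by (rule Bochner_Integration.integrable_bound[OF B meas[OF that]])
       (use bd[OF that] in \<open>auto intro!: AE_I2 intro: order_trans[OF _ abs_ge_self]\<close>)
  \<comment> \<open>Discs of radius \<open>r/4\<close> about points of \<open>ball z0 (r/2)\<close>
    stay inside \<open>ball z0 r\<close>; this is the origin of the factor
    \<open>4 / r\<close>.\<close>
  have der_bd: "norm (g' z t) \<le> 4 / r * B t" if z: "z \<in> ball z0 (r/2)" for z t
  proof -
    have sub: "cball z (r/4) \<subseteq> ball z0 r"
    proof
      fix w assume "w \<in> cball z (r/4)"
      then have "dist z0 w \<le> dist z0 z + r/4"
        using dist_triangle[of z0 w z] by auto
      then show "w \<in> ball z0 r" using z r by auto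
    qed
    have hol: "(\<lambda>z. g z t) holomorphic_on ball z0 r"
      unfolding holomorphic_on_open[OF open_ball] using der by blast
    have "norm ((deriv ^^ 1) (\<lambda>z. g z t) z) \<le> fact 1 * B t / (r/4) ^ 1"
    proof (rule Cauchy_inequality)
      show "(\<lambda>z. g z t) holomorphic_on ball z (r/4)"
        by (rule holomorphic_on_subset[OF hol]) (use sub in auto)
      show "continuous_on (cball z (r/4)) (\<lambda>z. g z t)"
        by (rule holomorphic_on_imp_continuous_on[OF holomorphic_on_subset[OF hol sub]])
      show "norm (g x t) \<le> B t" if "norm (z - x) = r/4" for x
        by (rule bd, rule subsetD[OF sub]) (use that in \<open>simp add: dist_norm\<close>)
    qed (use r in auto)
    moreover have "deriv (\<lambda>z. g z t) z = g' z t"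
      by (rule DERIV_imp_deriv, rule der) (use z r in auto)
    ultimately show ?thesis using r by (simp add: field_simps)
  qed
  have diff_bd: "norm (g w t - g z0 t) \<le> 4 / r * B t * norm (w - z0)" if w: "w \<in> ball z0 (r/2)" for w t
  proof (rule field_differentiable_bound[where S="ball z0 (r/2)"])
    fix z assume z: "z \<in> ball z0 (r/2)"
    then have "z \<in> ball z0 r" using r by auto
    from der[OF this, of t] show "((\<lambda>z. g z t) has_field_derivative g' z t) (at z within ball z0 (r/2))"
      by (rule has_field_derivative_at_within)
    show "norm (g' z t) \<le> 4 / r * B t" using der_bd[OF z] .
  qed (use w r in auto)
  show ?thesis
    unfolding DERIV_def
  proof (rule tendsto_at_iff_sequentially[THEN iffD2], intro allI impI)
    fix X :: "nat \<Rightarrow> complex" assume X: "\<forall>i. X i \<in> UNIV - {0}" "X \<longlonglongrightarrow> 0"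
    have X0: "X n \<noteq> 0" for n using X(1) by auto
    have ev: "\<forall>\<^sub>F n in sequentially. norm (X n) < r/2"
      using tendstoD[OF X(2), of "r/2"] r by simp
    \<comment> \<open>The quotient is cut off to 0 outside the half radius, so that the majorant
      holds for every \<open>n\<close>; the cut-off concerns only finitely many
      \<open>n\<close>.\<close>
    define q where "q n t = (if norm (X n) < r/2 then (g (z0 + X n) t - g z0 t) / X n else 0)" for n t
    have qm: "q n \<in> borel_measurable M" for n
    proof (cases "norm (X n) < r/2")
      case True
      have [measurable]: "g (z0 + X n) \<in> borel_measurable M" "g z0 \<in> borel_measurable M"
        using True r by (auto intro!: meas simp: dist_norm)
      show ?thesis using True unfolding q_def[abs_def] by simp
    qed (simp add: q_def[abs_def])
    have ql: "(\<lambda>n. q n t) \<longlonglongrightarrow> g' z0 t" for t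
    proof -
      have "((\<lambda>h. (g (z0 + h) t - g z0 t) / h) \<longlongrightarrow> g' z0 t) (at 0)"
        using der[of z0 t] r unfolding DERIV_def by simp
      then have "(\<lambda>n. (g (z0 + X n) t - g z0 t) / X n) \<longlonglongrightarrow> g' z0 t"
        using X by (auto simp: tendsto_at_iff_sequentially o_def)
      then show ?thesis
        by (rule Lim_transform_eventually) (use ev in eventually_elim, simp add: q_def)
    qed
    have "(\<lambda>n. LINT t|M. q n t) \<longlonglongrightarrow> (LINT t|M. g' z0 t)"
    proof (rule integral_dominated_convergence[where w="\<lambda>t. 4 / r * B t"])
      show "g' z0 \<in> borel_measurable M"
        by (rule borel_measurable_LIMSEQ_metric[OF qm ql])
      show "integrable M (\<lambda>t. 4 / r * B t)" using B by simp
      fix n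
      show "AE t in M. norm (q n t) \<le> 4 / r * B t"
      proof (rule AE_I2)
        fix t
        have B0: "0 \<le> B t" using bd[of z0 t] r by (auto intro: order_trans[OF norm_ge_zero])
        show "norm (q n t) \<le> 4 / r * B t"
        proof (cases "norm (X n) < r/2")
          case True
          have "norm (g (z0 + X n) t - g z0 t) \<le> 4 / r * B t * norm (X n)"
            using diff_bd[of "z0 + X n" t] True by (simp add: dist_norm)
          then show ?thesis using True X0[of n] by (simp add: q_def norm_divide pos_divide_le_eq)
        qed (use B0 r in \<open>simp add: q_def\<close>)
      qed
    qed (use qm ql in auto)
    then show "((\<lambda>h. ((LINT t|M. g (z0 + h) t) - (LINT t|M. g z0 t)) / h) \<circ> X) \<longlonglongrightarrow> (LINT t|M. g' z0 t)"
      unfolding o_def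
    proof (rule Lim_transform_eventually)
      show "\<forall>\<^sub>F n in sequentially. (LINT t|M. q n t) = ((LINT t|M. g (z0 + X n) t) - (LINT t|M. g z0 t)) / X n"
        using ev
      proof eventually_elim
        case (elim n)
        have "integrable M (g (z0 + X n))" "integrable M (g z0)"
          using elim r by (auto intro!: ig simp: dist_norm)
        then show ?case using elim by (simp add: q_def)
      qed
    qed
  qed
qed

text \<open>The positive and negative parts of \<open>v\<close> have equal Fourier transforms, and
  equal total mass by evaluation at 0. Divided by that mass they are densities of probability
  measures with the same characteristic function, so uniqueness of characteristic functions applies.
  Zero mass is a case of its own because it cannot be normalised.\<close>

lemma Fourier_injective_real:
  fixes v :: "real \<Rightarrow> real"
  assumes v: "integrable lborel v"
    and zero: "\<And>y. (LINT t|lborel. of_real (v t) * iexp (y * t)) = 0"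
  shows "AE t in lborel. v t = 0"
proof -
  have vm[measurable]: "v \<in> borel_measurable borel" using v by auto
  define P where "P t = max (v t) 0" for t
  define N where "N t = max (- v t) 0" for t
  have m[measurable]: "P \<in> borel_measurable borel" "N \<in> borel_measurable borel"
    unfolding P_def[abs_def] N_def[abs_def] by measurable
  have nn: "P t \<ge> 0" "N t \<ge> 0" and vPN: "v t = P t - N t" for t by (auto simp: P_def N_def)
  have iP: "integrable lborel P" and iN: "integrable lborel N"
    by (rule Bochner_Integration.integrable_bound[OF v]; force simp: P_def N_def)+
  have ie: "integrable lborel (\<lambda>t. of_real (h t) * iexp (y * t))" if "integrable lborel h" for h y
  proof -
    have [measurable]: "h \<in> borel_measurable borel" using that by auto
    show ?thesis
      by (rule Bochner_Integration.integrable_bound[OF that]) (auto simp: norm_mult)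
  qed
  have eq: "(LINT t|lborel. of_real (P t) * iexp (y * t)) = (LINT t|lborel. of_real (N t) * iexp (y * t))" for y
    using zero[of y] Bochner_Integration.integral_diff[OF ie[OF iP, of y] ie[OF iN, of y]]
    by (simp add: vPN algebra_simps)
  define c where "c = (LINT t|lborel. P t)"
  have cN: "c = (LINT t|lborel. N t)"
    using eq[of 0] unfolding c_def by simp
  have c0: "c \<ge> 0" unfolding c_def by (simp add: nn)
  show ?thesis
  proof (cases "c = 0")
    case True
    have "AE t in lborel. P t = 0"
      using integral_nonneg_eq_0_iff_AE[OF iP] True nn by (simp add: c_def)
    moreover have "AE t in lborel. N t = 0"
      using integral_nonneg_eq_0_iff_AE[OF iN] True nn by (simp add: cN)
    ultimately show ?thesis by eventually_elim (simp add: vPN)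
  next
    case False
    with c0 have c: "c > 0" by simp
    define D :: "(real \<Rightarrow> real) \<Rightarrow> real measure" where "D h = density lborel (\<lambda>t. ennreal (h t / c))" for h
    have rd: "real_distribution (D h)"
      and ch: "char (D h) y = (LINT t|lborel. of_real (h t) * iexp (y * t)) / c"
      if h: "integrable lborel h" "\<And>t. h t \<ge> 0" "(LINT t|lborel. h t) = c" for h y
    proof -
      have [measurable]: "h \<in> borel_measurable borel" using h by auto
      have "emeasure (D h) (space (D h)) = (\<integral>\<^sup>+ t. ennreal (h t / c) \<partial>lborel)"
        unfolding D_def by (simp add: emeasure_density)
      also have "\<dots> = ennreal (LINT t|lborel. h t / c)"
        using h c by (intro nn_integral_eq_integral) auto
      also have "\<dots> = 1" using h c by simp
      finally have "prob_space (D h)" by (rule prob_spaceI)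
      then show "real_distribution (D h)"
        unfolding real_distribution_def real_distribution_axioms_def by (simp add: D_def)
      have "char (D h) y = (LINT t|lborel. (h t / c) *\<^sub>R iexp (y * t))"
        unfolding char_def D_def using h c by (intro integral_density) auto
      also have "\<dots> = (LINT t|lborel. (of_real (h t) * iexp (y * t)) / c)"
        by (simp add: scaleR_conv_of_real)
      finally show "char (D h) y = (LINT t|lborel. of_real (h t) * iexp (y * t)) / c" by simp
    qed
    have "D P = D N"
    proof (rule Levy_uniqueness)
      show "real_distribution (D P)" by (rule rd[OF iP nn(1) c_def[symmetric]])
      show "real_distribution (D N)" by (rule rd[OF iN nn(2) cN[symmetric]])
      show "char (D P) = char (D N)"
        by (rule ext) (simp only: ch[OF iP nn(1) c_def[symmetric]] ch[OF iN nn(2) cN[symmetric]] eq)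
    qed
    then have "AE t in lborel. ennreal (P t / c) = ennreal (N t / c)"
      unfolding D_def by (intro sigma_finite_measure.density_unique[OF lborel.sigma_finite_measure_axioms]) auto
    then show ?thesis
    proof eventually_elim
      case (elim t)
      then show ?case using c nn[of t] by (simp add: vPN)
    qed
  qed
qed

text \<open>The transform of \<open>cnj u\<close> is the conjugate of the transform of
  \<open>u\<close> at the reflected frequency, so it vanishes too; the real and imaginary parts are
  combinations of the two.\<close>

lemma Fourier_injective:
  fixes u :: "real \<Rightarrow> complex"
  assumes u: "integrable lborel u"
    and zero: "\<And>y. (LINT t|lborel. u t * iexp (y * t)) = 0"
  shows "AE t in lborel. u t = 0"
proof -
  have um[measurable]: "u \<in> borel_measurable borel" using u by auto
  have ie: "integrable lborel (\<lambda>t. u t * iexp (y * t))" for y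
    by (rule Bochner_Integration.integrable_bound[OF u]) (auto simp: norm_mult)
  have ic: "integrable lborel (\<lambda>t. cnj (u t) * iexp (y * t))" for y
    by (rule Bochner_Integration.integrable_bound[OF u]) (auto simp: norm_mult)
  have zc: "(LINT t|lborel. cnj (u t) * iexp (y * t)) = 0" for y
  proof -
    have "(LINT t|lborel. cnj (u t) * iexp (y * t)) = (LINT t|lborel. cnj (u t * iexp (- y * t)))"
      by (rule Bochner_Integration.integral_cong) (simp_all add: exp_cnj)
    also have "\<dots> = 0" unfolding Bochner_Integration.integral_cnj zero by simp
    finally show ?thesis .
  qed
  have "AE t in lborel. Re (u t) = 0"
  proof (rule Fourier_injective_real)
    fix y
    have "(LINT t|lborel. of_real (Re (u t)) * iexp (y * t)) =
      (LINT t|lborel. (u t * iexp (y * t) + cnj (u t) * iexp (y * t)) / 2)"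
      by (rule Bochner_Integration.integral_cong) (simp_all flip: distrib_right add: complex_add_cnj)
    also have "\<dots> = 0" using ie[of y] ic[of y] zero[of y] zc[of y] by simp
    finally show "(LINT t|lborel. of_real (Re (u t)) * iexp (y * t)) = 0" .
  qed (use u in simp)
  moreover have "AE t in lborel. Im (u t) = 0"
  proof (rule Fourier_injective_real)
    fix y
    have "(LINT t|lborel. of_real (Im (u t)) * iexp (y * t)) =
      (LINT t|lborel. (u t * iexp (y * t) - cnj (u t) * iexp (y * t)) / (2 * \<i>))"
    proof (rule Bochner_Integration.integral_cong[OF refl])
      fix t
      have "of_real (Im (u t)) = (u t - cnj (u t)) / (2 * \<i>)" by (simp add: complex_eq_iff)
      then show "of_real (Im (u t)) * iexp (y * t) = (u t * iexp (y * t) - cnj (u t) * iexp (y * t)) / (2 * \<i>)"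
        by (simp only: times_divide_eq_left left_diff_distrib)
    qed
    also have "\<dots> = 0" using ie[of y] ic[of y] zero[of y] zc[of y] by simp
    finally show "(LINT t|lborel. of_real (Im (u t)) * iexp (y * t)) = 0" .
  qed (use u in simp)
  ultimately show ?thesis by eventually_elim (simp add: complex_eq_iff)
qed

section \<open>Polynomials times Gaussians\<close>

lemma norm_poly_le_exp: "\<exists>C d. C \<ge> 0 \<and> d \<ge> 0 \<and> (\<forall>z::complex. norm (poly r z) \<le> C * exp (d * norm z))"
proof (induction r)
  case 0
  show ?case by (intro exI[of _ 0]) simp
next
  case (pCons a r)
  then obtain C d where C: "C \<ge> 0" "d \<ge> 0" "\<And>z. norm (poly r z) \<le> C * exp (d * norm z)" by auto
  show ?case
  proof (intro exI conjI allI)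
    show "norm a + C \<ge> 0" "d + 1 \<ge> 0" using C by auto
    fix z :: complex
    have 1: "norm z \<le> exp (norm z)" using exp_ge_add_one_self[of "norm z"] by linarith
    have 2: "1 \<le> exp ((d + 1) * norm z)" using C by simp
    have "norm (poly (pCons a r) z) \<le> norm a + norm z * norm (poly r z)"
      by (simp add: norm_triangle_le norm_mult)
    also have "\<dots> \<le> norm a * exp ((d + 1) * norm z) + exp (norm z) * (C * exp (d * norm z))"
    proof (intro add_mono mult_mono 1 C)
      show "norm a \<le> norm a * exp ((d + 1) * norm z)"
        using mult_left_mono[OF 2 norm_ge_zero[of a]] by simp
    qed (use C in auto)
    also have "\<dots> = (norm a + C) * exp ((d + 1) * norm z)"
      by (simp add: algebra_simps exp_add)
    finally show "norm (poly (pCons a r) z) \<le> (norm a + C) * exp ((d + 1) * norm z)" .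
  qed
qed

text \<open>Half of the quadratic decay absorbs the linear growth, by expanding the square of
  \<open>d - c * \<bar>t\<bar>\<close>; the other half is a multiple of a normal density of variance
  \<open>1 / c\<close>.\<close>

lemma gaussian_integrable:
  fixes c d :: real
  assumes c: "c > 0"
  shows "integrable lborel (\<lambda>t. exp (d * \<bar>t\<bar> - c * t\<^sup>2))"
proof -
  define s where "s = 1 / sqrt c"
  have s: "s > 0" "s\<^sup>2 = 1 / c" using c by (auto simp: s_def power_divide)
  have "integrable lborel (\<lambda>t. sqrt (2 * pi * s\<^sup>2) * exp (d\<^sup>2 / (2 * c)) * normal_density 0 s t)"
    using s by auto
  then show ?thesis
  proof (rule Bochner_Integration.integrable_bound)
    show "AE t in lborel. norm (exp (d * \<bar>t\<bar> - c * t\<^sup>2))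
       \<le> norm (sqrt (2 * pi * s\<^sup>2) * exp (d\<^sup>2 / (2 * c)) * normal_density 0 s t)"
    proof (rule AE_I2)
      fix t :: real
      have "0 \<le> (d - c * \<bar>t\<bar>)\<^sup>2 / (2 * c)" using c by simp
      also have "\<dots> = d\<^sup>2 / (2 * c) - d * \<bar>t\<bar> + c * t\<^sup>2 / 2"
        using c by (simp add: power2_diff power_mult_distrib) (simp add: field_simps power2_eq_square)
      finally have "d * \<bar>t\<bar> - c * t\<^sup>2 \<le> d\<^sup>2 / (2 * c) + - (c * t\<^sup>2 / 2)" by simp
      then have "exp (d * \<bar>t\<bar> - c * t\<^sup>2) \<le> exp (d\<^sup>2 / (2 * c)) * exp (- (c * t\<^sup>2 / 2))"
        by (simp flip: exp_add)
      also have "\<dots> = sqrt (2 * pi * s\<^sup>2) * exp (d\<^sup>2 / (2 * c)) * normal_density 0 s t"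
        using s c by (simp add: normal_density_def)
      finally show "norm (exp (d * \<bar>t\<bar> - c * t\<^sup>2)) \<le> norm (sqrt (2 * pi * s\<^sup>2) * exp (d\<^sup>2 / (2 * c)) * normal_density 0 s t)"
        by simp
    qed
  qed simp
qed

lemma borel_measurable_poly [measurable (raw)]:
  fixes r :: "complex poly"
  assumes "h \<in> borel_measurable M"
  shows "(\<lambda>t. poly r (h t)) \<in> borel_measurable M"
  using assms by (rule borel_measurable_continuous_on[rotated]) (intro continuous_intros)

lemma norm_poly_gauss_le:
  fixes r :: "complex poly"
  shows "\<exists>C d. C \<ge> 0 \<and> (\<forall>t::real. norm (poly r (of_real t) * exp (- \<gamma> * (of_real t)\<^sup>2 + z * of_real t)) \<le>
     C * exp (d * \<bar>t\<bar> - Re \<gamma> * t\<^sup>2))"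
proof -
  obtain C d where C: "C \<ge> 0" "\<And>z::complex. norm (poly r z) \<le> C * exp (d * norm z)"
    using norm_poly_le_exp[of r] by auto
  show ?thesis
  proof (intro exI conjI allI)
    show "C \<ge> 0" by fact
    fix t :: real
    have "Re (- \<gamma> * (of_real t)\<^sup>2 + z * of_real t) = - Re \<gamma> * t\<^sup>2 + Re z * t"
      by (simp flip: of_real_power)
    also have "\<dots> \<le> \<bar>Re z\<bar> * \<bar>t\<bar> - Re \<gamma> * t\<^sup>2"
      by (simp flip: abs_mult)
    finally have "norm (exp (- \<gamma> * (of_real t)\<^sup>2 + z * of_real t)) \<le> exp (\<bar>Re z\<bar> * \<bar>t\<bar> - Re \<gamma> * t\<^sup>2)"
      by simp
    then have "norm (poly r (of_real t) * exp (- \<gamma> * (of_real t)\<^sup>2 + z * of_real t)) \<le>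
      (C * exp (d * \<bar>t\<bar>)) * exp (\<bar>Re z\<bar> * \<bar>t\<bar> - Re \<gamma> * t\<^sup>2)"
      unfolding norm_mult using C(2)[of "of_real t"] C(1) by (intro mult_mono) auto
    also have "\<dots> = C * exp ((d + \<bar>Re z\<bar>) * \<bar>t\<bar> - Re \<gamma> * t\<^sup>2)"
      by (simp add: exp_add[symmetric] algebra_simps)
    finally show "norm (poly r (of_real t) * exp (- \<gamma> * (of_real t)\<^sup>2 + z * of_real t)) \<le>
      C * exp ((d + \<bar>Re z\<bar>) * \<bar>t\<bar> - Re \<gamma> * t\<^sup>2)" .
  qed
qed

lemma poly_gauss_integrable:
  fixes r :: "complex poly"
  assumes "Re \<gamma> > 0"
  shows "integrable lborel (\<lambda>t::real. poly r (of_real t) * exp (- \<gamma> * (of_real t)\<^sup>2 + z * of_real t))"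
proof -
  obtain C d where C: "C \<ge> 0" "\<And>t::real. norm (poly r (of_real t) * exp (- \<gamma> * (of_real t)\<^sup>2 + z * of_real t)) \<le>
     C * exp (d * \<bar>t\<bar> - Re \<gamma> * t\<^sup>2)"
    using norm_poly_gauss_le by blast
  show ?thesis
  proof (rule Bochner_Integration.integrable_bound)
    show "integrable lborel (\<lambda>t. C * exp (d * \<bar>t\<bar> - Re \<gamma> * t\<^sup>2))"
      using gaussian_integrable[OF assms, of d] by simp
    show "AE t::real in lborel. norm (poly r (of_real t) * exp (- \<gamma> * (of_real t)\<^sup>2 + z * of_real t)) \<le>
       norm (C * exp (d * \<bar>t\<bar> - Re \<gamma> * t\<^sup>2))"
      using C by (intro AE_I2) simp
  qed measurable
qed

text \<open>The integrand is the derivative of the polynomial \<open>r\<close> times the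
  exponential, and that product tends to 0 at both ends.\<close>

lemma poly_gauss_by_parts:
  fixes r :: "complex poly"
  assumes \<gamma>: "Re \<gamma> > 0"
  shows "(LINT t|lborel. (poly (pderiv r + [:z, - 2 * \<gamma>:] * r) (of_real t)) * exp (- \<gamma> * (of_real t)\<^sup>2 + z * of_real t)) = 0"
proof -
  let ?F = "\<lambda>t::real. poly r (of_real t) * exp (- \<gamma> * (of_real t)\<^sup>2 + z * of_real t)"
  let ?f = "\<lambda>t::real. poly (pderiv r + [:z, - 2 * \<gamma>:] * r) (of_real t) * exp (- \<gamma> * (of_real t)\<^sup>2 + z * of_real t)"
  obtain C d where C: "C \<ge> 0" "\<And>t. norm (?F t) \<le> C * exp (d * \<bar>t\<bar> - Re \<gamma> * t\<^sup>2)"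
    using norm_poly_gauss_le by blast
  have lim: "((\<lambda>t. C * exp (d * \<bar>t\<bar> - Re \<gamma> * t\<^sup>2)) \<longlongrightarrow> 0) at_top" "((\<lambda>t. C * exp (d * \<bar>t\<bar> - Re \<gamma> * t\<^sup>2)) \<longlongrightarrow> 0) at_bot"
    using \<gamma> by real_asymp+
  have lF: "(?F \<longlongrightarrow> 0) at_top" "(?F \<longlongrightarrow> 0) at_bot"
    using C(2) by (auto intro!: Lim_null_comparison[OF _ lim(1)] Lim_null_comparison[OF _ lim(2)] always_eventually)
  have "(LBINT t=-\<infinity>..\<infinity>. ?f t) = 0 - 0"
  proof (rule interval_integral_FTC_integrable)
    fix t :: real
    have "((\<lambda>w. poly r w * exp (- \<gamma> * w\<^sup>2 + z * w)) has_field_derivative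
       (poly (pderiv r + [:z, - 2 * \<gamma>:] * r) (of_real t) * exp (- \<gamma> * (of_real t)\<^sup>2 + z * of_real t))) (at (of_real t))"
      by (rule derivative_eq_intros poly_DERIV refl | simp)+ (simp add: algebra_simps)
    from has_vector_derivative_real_field[OF this]
    show "(?F has_vector_derivative ?f t) (at t)" by simp
    show "isCont ?f t" by (intro continuous_intros)
  next
    show "set_integrable lborel (einterval (- \<infinity>) \<infinity>) ?f"
      unfolding set_integrable_def einterval_eq_UNIV
      by (simp only: indicator_UNIV scaleR_one) (rule poly_gauss_integrable[OF \<gamma>])
    show "((?F \<circ> real_of_ereal) \<longlongrightarrow> 0) (at_right (- \<infinity>))"
      using lF(2) by (simp add: ereal_tendsto_simps)
    show "((?F \<circ> real_of_ereal) \<longlongrightarrow> 0) (at_left \<infinity>)"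
      using lF(1) by (simp add: ereal_tendsto_simps)
  qed auto
  then show ?thesis
    by (simp add: interval_lebesgue_integral_def einterval_eq_UNIV set_lebesgue_integral_def)
qed

text \<open>Integration by parts shows that the integral \<open>G\<close> has derivative
  \<open>z / (2 * \<gamma>) * G z\<close>, which determines \<open>G\<close> up to a constant. The
  constant is a square root of \<open>pi / \<gamma>\<close> with \<open>\<gamma>\<close> complex;
  stating only that it is nonzero avoids the choice of a branch. A zero constant would contradict
  Fourier injectivity.\<close>

lemma gaussian_integral:
  assumes \<gamma>: "Re \<gamma> > 0"
  shows "\<exists>C. C \<noteq> 0 \<and> (\<forall>z. (LINT t|lborel. exp (- \<gamma> * (of_real t)\<^sup>2 + z * of_real t)) = C * exp (z\<^sup>2 / (4 * \<gamma>)))"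
proof -
  define G where "G z = (LINT t|lborel. exp (- \<gamma> * (of_real t)\<^sup>2 + z * of_real t))" for z
  have \<gamma>0: "\<gamma> \<noteq> 0" using \<gamma> by auto
  have dG: "(G has_field_derivative (z / (2 * \<gamma>) * G z)) (at z)" for z
  proof -
    have "((\<lambda>z. LINT t|lborel. exp (- \<gamma> * (of_real t)\<^sup>2 + z * of_real t)) has_field_derivative
       (LINT t|lborel. of_real t * exp (- \<gamma> * (of_real t)\<^sup>2 + z * of_real t))) (at z)"
    proof (rule has_field_derivative_integral[where r=1])
      show "integrable lborel (\<lambda>t. exp ((norm z + 1) * \<bar>t\<bar> - Re \<gamma> * t\<^sup>2))"
        by (rule gaussian_integrable[OF \<gamma>])
      fix w t assume "w \<in> ball z 1"
      then have w: "norm w \<le> norm z + 1"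
        using norm_triangle_ineq2[of w z] by (simp add: dist_norm norm_minus_commute)
      have "Re (- \<gamma> * (of_real t)\<^sup>2 + w * of_real t) = - Re \<gamma> * t\<^sup>2 + Re w * t"
        by (simp flip: of_real_power)
      moreover have "\<bar>Re w * t\<bar> \<le> (norm z + 1) * \<bar>t\<bar>"
        unfolding abs_mult using abs_Re_le_cmod[of w] w by (intro mult_right_mono) auto
      ultimately have "Re (- \<gamma> * (of_real t)\<^sup>2 + w * of_real t) \<le> (norm z + 1) * \<bar>t\<bar> - Re \<gamma> * t\<^sup>2"
        by linarith
      then show "norm (exp (- \<gamma> * (of_real t)\<^sup>2 + w * of_real t)) \<le> exp ((norm z + 1) * \<bar>t\<bar> - Re \<gamma> * t\<^sup>2)"
        by (simp only: norm_exp_eq_Re exp_le_cancel_iff)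
      show "((\<lambda>w. exp (- \<gamma> * (of_real t)\<^sup>2 + w * of_real t)) has_field_derivative
         of_real t * exp (- \<gamma> * (of_real t)\<^sup>2 + w * of_real t)) (at w)"
        by (auto intro!: derivative_eq_intros)
    qed auto
    moreover have "(LINT t|lborel. of_real t * exp (- \<gamma> * (of_real t)\<^sup>2 + z * of_real t)) = z / (2 * \<gamma>) * G z"
    proof -
      have i1: "integrable lborel (\<lambda>t. z * exp (- \<gamma> * (of_real t)\<^sup>2 + z * of_real t))"
        using poly_gauss_integrable[OF \<gamma>, of "[:z:]" z] by simp
      have i2: "integrable lborel (\<lambda>t. of_real t * exp (- \<gamma> * (of_real t)\<^sup>2 + z * of_real t))"
        using poly_gauss_integrable[OF \<gamma>, of "[:0, 1:]" z] by simp
      have "0 = (LINT t|lborel. z * exp (- \<gamma> * (of_real t)\<^sup>2 + z * of_real t) - (2 * \<gamma>) * (of_real t * exp (- \<gamma> * (of_real t)\<^sup>2 + z * of_real t)))"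
        using poly_gauss_by_parts[OF \<gamma>, of 1 z] by (simp add: algebra_simps)
      also have "\<dots> = z * G z - (2 * \<gamma>) * (LINT t|lborel. of_real t * exp (- \<gamma> * (of_real t)\<^sup>2 + z * of_real t))"
        unfolding G_def
        by (subst Bochner_Integration.integral_diff[OF i1 integrable_mult_right[OF i2]])
           (simp only: integral_mult_right_zero)
      finally show ?thesis using \<gamma>0 by (simp add: field_simps)
    qed
    ultimately show ?thesis unfolding G_def[abs_def] by simp
  qed
  have "((\<lambda>z. G z * exp (- (z\<^sup>2 / (4 * \<gamma>)))) has_field_derivative 0) (at z)" for z
    by (rule derivative_eq_intros dG refl | use \<gamma>0 in simp)+
  then have "\<exists>c. \<forall>z\<in>UNIV. G z * exp (- (z\<^sup>2 / (4 * \<gamma>))) = c"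
    by (intro has_field_derivative_zero_constant) (auto intro: has_field_derivative_at_within)
  then obtain C where C: "\<And>z. G z * exp (- (z\<^sup>2 / (4 * \<gamma>))) = C" by auto
  have G: "G z = C * exp (z\<^sup>2 / (4 * \<gamma>))" for z
    using C[of z] by (auto simp: exp_minus field_simps)
  have "C \<noteq> 0"
  proof
    assume "C = 0"
    then have z: "G z = 0" for z using G by simp
    have "AE t in lborel. exp (- \<gamma> * (complex_of_real t)\<^sup>2) = 0"
    proof (rule Fourier_injective)
      show "integrable lborel (\<lambda>t. exp (- \<gamma> * (complex_of_real t)\<^sup>2))"
        using poly_gauss_integrable[OF \<gamma>, of 1 0] by simp
      show "(LINT t|lborel. exp (- \<gamma> * (complex_of_real t)\<^sup>2) * iexp (y * t)) = 0" for y
        using z[of "\<i> * of_real y"] unfolding G_def exp_add by (simp add: mult.assoc)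
    qed
    then show False by (simp add: eventually_False ae_filter_eq_bot_iff)
  qed
  then show ?thesis using G unfolding G_def by blast
qed

text \<open>Integration by parts turns multiplication of the transform by \<open>z\<close> into an operation on \<open>r\<close>.\<close>

lemma poly_gauss_surj:
  assumes \<gamma>: "Re \<gamma> > 0"
  shows "\<exists>r. \<forall>z. (LINT t|lborel. poly r (of_real t) * exp (- \<gamma> * (of_real t)\<^sup>2 + z * of_real t)) = poly P z * exp (z\<^sup>2 / (4 * \<gamma>))"
proof (induction P)
  case 0
  show ?case by (intro exI[of _ 0]) simp
next
  case (pCons a P)
  let ?E = "\<lambda>z t. exp (- \<gamma> * (complex_of_real t)\<^sup>2 + z * of_real t)"
  obtain C where C: "C \<noteq> 0" "\<And>z. (LINT t|lborel. ?E z t) = C * exp (z\<^sup>2 / (4 * \<gamma>))"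
    using gaussian_integral[OF \<gamma>] by auto
  obtain r where r: "\<And>z. (LINT t|lborel. poly r (of_real t) * ?E z t) = poly P z * exp (z\<^sup>2 / (4 * \<gamma>))"
    using pCons.IH by auto
  let ?q = "pderiv r + [:0, - 2 * \<gamma>:] * r"
  show ?case
  proof (intro exI allI)
    fix z
    have i: "integrable lborel (\<lambda>t. poly q (of_real t) * ?E z t)" for q
      by (rule poly_gauss_integrable[OF \<gamma>])
    have q: "(LINT t|lborel. poly ?q (of_real t) * ?E z t) = - z * (LINT t|lborel. poly r (of_real t) * ?E z t)"
    proof -
      have "poly (pderiv r + [:z, - 2 * \<gamma>:] * r) x = poly ?q x + z * poly r x" for x by (simp add: algebra_simps)
      then have "0 = (LINT t|lborel. poly ?q (of_real t) * ?E z t + z * (poly r (of_real t) * ?E z t))"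
        using poly_gauss_by_parts[OF \<gamma>, of r z] by (simp only: distrib_right mult.assoc)
      also have "\<dots> = (LINT t|lborel. poly ?q (of_real t) * ?E z t) + z * (LINT t|lborel. poly r (of_real t) * ?E z t)"
        by (subst Bochner_Integration.integral_add[OF i integrable_mult_right[OF i]]) (simp only: integral_mult_right_zero)
      finally show ?thesis by (simp add: eq_neg_iff_add_eq_0)
    qed
    have "(LINT t|lborel. poly ([:a / C:] - ?q) (of_real t) * ?E z t) =
      (LINT t|lborel. a / C * ?E z t - poly ?q (of_real t) * ?E z t)"
      by (simp add: left_diff_distrib)
    also have "\<dots> = a / C * (LINT t|lborel. ?E z t) - (LINT t|lborel. poly ?q (of_real t) * ?E z t)"
      using i[of "[:a/C:]"] by (subst Bochner_Integration.integral_diff[OF _ i]) (simp_all)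
    also have "\<dots> = poly (pCons a P) z * exp (z\<^sup>2 / (4 * \<gamma>))"
      unfolding q r C(2) using C(1) by (simp add: algebra_simps)
    finally show "(LINT t|lborel. poly ([:a / C:] - ?q) (of_real t) * ?E z t) = poly (pCons a P) z * exp (z\<^sup>2 / (4 * \<gamma>))" .
  qed
qed

section \<open>The Bargmann-type transform\<close>

lemma L2_poly_gauss:
  assumes "Re \<gamma> > 0"
  shows "L2_real (\<lambda>t. poly r (of_real t) * exp (- \<gamma> * (of_real t)\<^sup>2 + z * of_real t))"
  unfolding L2_real_def
proof
  have "(norm (poly r (of_real t) * exp (- \<gamma> * (of_real t)\<^sup>2 + z * of_real t)))\<^sup>2 =
     norm (poly (r * r) (of_real t) * exp (- (2 * \<gamma>) * (of_real t)\<^sup>2 + (2 * z) * of_real t))" for t :: real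
  proof -
    have "2 * (- \<gamma> * (of_real t)\<^sup>2 + z * of_real t) = - (2 * \<gamma>) * (of_real t)\<^sup>2 + (2 * z) * of_real t"
      by (simp add: algebra_simps)
    then have "exp (- (2 * \<gamma>) * (of_real t)\<^sup>2 + (2 * z) * of_real t) = (exp (- \<gamma> * (of_real t)\<^sup>2 + z * of_real t))\<^sup>2"
      by (metis exp_double)
    then show ?thesis
      by (simp only: poly_mult norm_mult norm_power) (simp only: power2_eq_square mult_ac)
  qed
  then show "integrable lborel (\<lambda>t. (norm (poly r (of_real t) * exp (- \<gamma> * (of_real t)\<^sup>2 + z * of_real t)))\<^sup>2)"
    using poly_gauss_integrable[of "2 * \<gamma>" "r * r" "2 * z"] assms by (simp only:) (simp add: integrable_norm)
qed measurable

text \<open>The polynomial weight \<open>r\<close> keeps the family closed under differentiation in \<open>z\<close>.\<close>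

definition bargmann :: "(real \<Rightarrow> complex) \<Rightarrow> complex poly \<Rightarrow> complex \<Rightarrow> complex" where
  "bargmann f r z = (LINT u|lborel. f u * (poly r (of_real u) * exp (- (1/2) * (of_real u)\<^sup>2 + z * of_real u)))"

lemma bargmann_integrable:
  assumes f: "L2_real f"
  shows "integrable lborel (\<lambda>u. f u * (poly r (of_real u) * exp (- (1/2) * (of_real u)\<^sup>2 + z * of_real u)))"
  by (intro L2_mult_integrable f L2_poly_gauss) simp

lemma bargmann_has_field_derivative:
  assumes f: "L2_real f"
  shows "(bargmann f r has_field_derivative bargmann f (pCons 0 r) z) (at z)"
  unfolding bargmann_def[abs_def]
proof (rule has_field_derivative_integral[where r=1])
  have [measurable]: "f \<in> borel_measurable borel" using f by (simp add: L2_real_def)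
  let ?R = "norm z + 1"
  let ?h = "\<lambda>w u. f u * (poly r (of_real u) * exp (- (1/2) * (of_real u)\<^sup>2 + w * of_real u))"
  \<comment> \<open>The modulus of the integrand depends on \<open>w\<close> only through
    \<open>exp (Re w * u)\<close>, which is at most the sum of its values at the real points
    \<open>?R\<close> and \<open>- ?R\<close>. The majorant is thus built from two integrands of the
    same family, already known to be integrable.\<close>
  show "integrable lborel (\<lambda>u. norm (?h (of_real ?R) u) + norm (?h (of_real (- ?R)) u))"
    by (intro Bochner_Integration.integrable_add integrable_norm bargmann_integrable f)
  fix w u assume "w \<in> ball z 1"
  then have w: "norm w \<le> ?R"
    using norm_triangle_ineq2[of w z] by (simp add: dist_norm norm_minus_commute)
  have "\<bar>Re w * u\<bar> \<le> ?R * \<bar>u\<bar>"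
    unfolding abs_mult using abs_Re_le_cmod[of w] w by (intro mult_right_mono) auto
  then have "Re w * u \<le> ?R * u \<or> Re w * u \<le> - ?R * u"
  proof -
    have "?R * \<bar>u\<bar> = ?R * u \<or> ?R * \<bar>u\<bar> = - ?R * u"
      by (cases "u \<ge> 0") (auto simp: algebra_simps)
    moreover have "Re w * u \<le> ?R * \<bar>u\<bar>"
      using \<open>\<bar>Re w * u\<bar> \<le> ?R * \<bar>u\<bar>\<close> by (rule abs_le_D1)
    ultimately show ?thesis by argo
  qed
  then have "exp (Re w * u) \<le> exp (?R * u) \<or> exp (Re w * u) \<le> exp (- ?R * u)"
    by (simp only: exp_le_cancel_iff)
  then have "exp (Re w * u) \<le> exp (?R * u) + exp (- ?R * u)"
    using exp_gt_zero[of "?R * u"] exp_gt_zero[of "- ?R * u"] by linarith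
  then have "exp (- (u\<^sup>2 / 2)) * exp (Re w * u) \<le> exp (- (u\<^sup>2 / 2)) * (exp (?R * u) + exp (- ?R * u))"
    by (intro mult_left_mono) auto
  moreover have nE: "norm (exp (- (1/2) * (complex_of_real u)\<^sup>2 + v * of_real u)) = exp (- (u\<^sup>2 / 2)) * exp (Re v * u)" for v
    by (simp add: exp_add[symmetric] flip: of_real_power)
  ultimately have "norm (exp (- (1/2) * (complex_of_real u)\<^sup>2 + w * of_real u)) \<le>
     norm (exp (- (1/2) * (complex_of_real u)\<^sup>2 + of_real ?R * of_real u)) + norm (exp (- (1/2) * (complex_of_real u)\<^sup>2 + of_real (- ?R) * of_real u))"
    unfolding nE by (simp add: distrib_left)
  then have "norm (f u * poly r (of_real u)) * norm (exp (- (1/2) * (complex_of_real u)\<^sup>2 + w * of_real u)) \<le>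
     norm (f u * poly r (of_real u)) * (norm (exp (- (1/2) * (complex_of_real u)\<^sup>2 + of_real ?R * of_real u)) + norm (exp (- (1/2) * (complex_of_real u)\<^sup>2 + of_real (- ?R) * of_real u)))"
    by (intro mult_left_mono) auto
  then show "norm (?h w u) \<le> norm (?h (of_real ?R) u) + norm (?h (of_real (- ?R)) u)"
    unfolding norm_mult by (simp only: distrib_left mult.assoc)
  show "((\<lambda>w. ?h w u) has_field_derivative
      f u * (poly (pCons 0 r) (of_real u) * exp (- (1/2) * (of_real u)\<^sup>2 + w * of_real u))) (at w)"
    by (auto intro!: derivative_eq_intros)
qed (use f in \<open>auto simp: L2_real_def\<close>)

text \<open>Completing the square turns the modulus of the kernel into
  \<open>exp ((Re z)\<^sup>2 / 2)\<close> times a Gaussian centred at \<open>Re z\<close>, whose L^2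
  norm does not depend on the centre. The bound is free of \<open>Im z\<close>;
  \<open>bargmann_exponent\<close> relies on this absence of growth along vertical lines.\<close>

lemma norm_bargmann_le:
  assumes f: "L2_real f"
  shows "\<exists>B. \<forall>z. norm (bargmann f 1 z) \<le> B * exp ((Re z)\<^sup>2 / 2)"
proof (intro exI allI)
  fix z
  let ?x = "Re z"
  define e where "e u = (of_real (exp (- (u - ?x)\<^sup>2 / 2)) :: complex)" for u
  have ex: "e u = of_real (exp (- ?x\<^sup>2 / 2)) * (poly 1 (of_real u) * exp (- (1/2) * (of_real u)\<^sup>2 + of_real ?x * of_real u))" for u
    unfolding e_def by (simp add: exp_of_real[symmetric] exp_add[symmetric] power2_eq_square algebra_simps add_divide_distrib diff_divide_distrib)
  have "L2_real (\<lambda>t. poly [:of_real (exp (- ?x\<^sup>2 / 2)):] (of_real t) * exp (- (1/2) * (of_real t)\<^sup>2 + of_real ?x * of_real t))"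
    by (rule L2_poly_gauss) simp
  then have Le: "L2_real e" unfolding ex[abs_def] by simp
  have ne: "(norm (e u))\<^sup>2 = exp (- (u - ?x)\<^sup>2)" for u
    unfolding e_def by (simp add: power2_eq_square flip: exp_add)
  have "(LINT u|lborel. exp (- (u - ?x)\<^sup>2)) = (LINT u|lborel. exp (- u\<^sup>2))"
    using integral_translate[of "\<lambda>u. exp (- (u - ?x)\<^sup>2)" ?x] by simp
  then have 1: "(LINT u|lborel. norm (f u * e u)) \<le> ((LINT x|lborel. (norm (f x))\<^sup>2) + (LINT u|lborel. exp (- u\<^sup>2))) / 2"
    using L2_mult_norm_integral_le[OF f Le, of 1] by (simp add: ne)
  have "norm (bargmann f 1 z) \<le> (LINT u|lborel. norm (f u * (poly 1 (of_real u) * exp (- (1/2) * (of_real u)\<^sup>2 + z * of_real u))))"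
    unfolding bargmann_def by (rule integral_norm_bound)
  also have "\<dots> = (LINT u|lborel. exp (?x\<^sup>2 / 2) * norm (f u * e u))"
  proof (rule Bochner_Integration.integral_cong[OF refl])
    fix u :: real
    have "Re (- (1/2) * (of_real u)\<^sup>2 + z * of_real u) = ?x\<^sup>2 / 2 + - (u - ?x)\<^sup>2 / 2"
      by (simp flip: of_real_power) (simp add: power2_eq_square algebra_simps add_divide_distrib diff_divide_distrib)
    then show "norm (f u * (poly 1 (of_real u) * exp (- (1/2) * (of_real u)\<^sup>2 + z * of_real u))) = exp (?x\<^sup>2 / 2) * norm (f u * e u)"
      unfolding e_def by (simp add: norm_mult exp_add[symmetric])
  qed
  also have "\<dots> = exp (?x\<^sup>2 / 2) * (LINT u|lborel. norm (f u * e u))" by simp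
  also have "\<dots> \<le> exp (?x\<^sup>2 / 2) * (((LINT x|lborel. (norm (f x))\<^sup>2) + (LINT u|lborel. exp (- u\<^sup>2))) / 2)"
    by (rule mult_left_mono[OF 1]) simp
  finally show "norm (bargmann f 1 z) \<le> ((LINT x|lborel. (norm (f x))\<^sup>2) + (LINT u|lborel. exp (- u\<^sup>2))) / 2 * exp (?x\<^sup>2 / 2)"
    by (simp add: mult.commute)
qed

section \<open>Gaussian averages of the Wigner transform as squared moduli\<close>

lemma unit_wigner_smooth_p:
  assumes f: "L2_real f"
    and C: "\<And>z. (LINT t|lborel. exp (- 1 * (of_real t)\<^sup>2 + z * of_real t)) = C * exp (z\<^sup>2 / (4 * 1))"
  shows "(LINT p|lborel. unit_wigner f x p * of_real (exp (- (p - p0)\<^sup>2))) =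
    C * (LINT t|lborel. f (x + t / 2) * cnj (f (x - t / 2)) * exp (- (\<i> * of_real (p0 * t)) - (of_real t)\<^sup>2 / 4))"
proof -
  have [measurable]: "f \<in> borel_measurable borel" using f by (simp add: L2_real_def)
  define a where "a t = f (x + t / 2) * cnj (f (x - t / 2))" for t
  have am[measurable]: "a \<in> borel_measurable borel" unfolding a_def[abs_def] by measurable
  have ia: "integrable lborel a" unfolding a_def[abs_def] by (rule unit_wigner_kernel_integrable[OF f])
  define h where "h p t = a t * exp (- (\<i> * of_real (p * t))) * complex_of_real (exp (- (p - p0)\<^sup>2))" for p t
  have nh: "norm (h p t) = norm (a t) * exp (- (p - p0)\<^sup>2)" for p t
    by (simp add: h_def norm_mult)
  have hm: "h p \<in> borel_measurable borel" for p unfolding h_def[abs_def] by measurable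
  have ig: "integrable lborel (\<lambda>p. exp (- (p - p0)\<^sup>2))"
    using integrable_translate[OF gaussian_integrable[of 1 0], of "- p0"] by simp
  have ih: "integrable (lborel \<Otimes>\<^sub>M lborel) (case_prod h)"
  proof (rule lborel_pair.Fubini_integrable)
    show "(\<lambda>(p, t). h p t) \<in> borel_measurable (lborel \<Otimes>\<^sub>M lborel)"
      unfolding h_def by measurable
    show "integrable lborel (\<lambda>p. LINT t|lborel. norm (case (p, t) of (p, t) \<Rightarrow> h p t))"
      using ig by (simp add: nh)
    show "AE p in lborel. integrable lborel (\<lambda>t. case (p, t) of (p, t) \<Rightarrow> h p t)"
    proof (rule AE_I2, simp)
      fix p
      show "integrable lborel (h p)"
        by (rule Bochner_Integration.integrable_bound[where f="\<lambda>t. exp (- (p - p0)\<^sup>2) *\<^sub>R a t"])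
           (use ia in \<open>auto simp: nh hm\<close>)
    qed
  qed
  have "(LINT p|lborel. unit_wigner f x p * of_real (exp (- (p - p0)\<^sup>2))) = (LINT p|lborel. LINT t|lborel. h p t)"
    unfolding unit_wigner_def h_def a_def by simp
  also have "\<dots> = (LINT t|lborel. LINT p|lborel. h p t)"
    by (rule lborel_pair.Fubini_integral[OF ih, symmetric])
  also have "\<dots> = (LINT t|lborel. C * (a t * exp (- (\<i> * of_real (p0 * t)) - (of_real t)\<^sup>2 / 4)))"
  proof (rule Bochner_Integration.integral_cong[OF refl])
    fix t :: real
    \<comment> \<open>Expanding the square in \<open>p\<close> gives the Gaussian integral at a
      complex point: its real part comes from the centre \<open>p0\<close>, its imaginary part from
      the phase of the Wigner kernel.\<close>
    let ?z = "of_real (2 * p0) - \<i> * of_real t"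
    have h: "h p t = (a t * exp (- (of_real p0)\<^sup>2)) * exp (- 1 * (of_real p)\<^sup>2 + ?z * of_real p)" for p
      unfolding h_def mult.assoc exp_of_real[symmetric] exp_add[symmetric]
      by (rule arg_cong[where f="\<lambda>e. a t * exp e"]) (simp add: power2_eq_square algebra_simps)
    have "(LINT p|lborel. h p t) = (a t * exp (- (of_real p0)\<^sup>2)) * (C * exp (?z\<^sup>2 / (4 * 1)))"
      unfolding h C[symmetric] by (rule integral_mult_right_zero)
    also have "\<dots> = C * (a t * (exp (- (of_real p0)\<^sup>2) * exp (?z\<^sup>2 / (4 * 1))))" by (simp add: mult_ac)
    also have "exp (- (of_real p0)\<^sup>2) * exp (?z\<^sup>2 / (4 * 1)) = exp (- (\<i> * of_real (p0 * t)) - (of_real t)\<^sup>2 / 4)"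
      unfolding exp_add[symmetric]
      by (rule arg_cong[where f=exp]) (simp add: power2_eq_square field_simps)
    finally show "(LINT p|lborel. h p t) = C * (a t * exp (- (\<i> * of_real (p0 * t)) - (of_real t)\<^sup>2 / 4))" .
  qed
  also have "\<dots> = C * (LINT t|lborel. a t * exp (- (\<i> * of_real (p0 * t)) - (of_real t)\<^sup>2 / 4))"
    by (rule integral_mult_right_zero)
  finally show ?thesis unfolding a_def .
qed

text \<open>In the variables \<open>u = x + t / 2\<close> and \<open>v = x - t / 2\<close> the
  exponents \<open>(x - x0)\<^sup>2\<close> and \<open>t\<^sup>2 / 4\<close> add up to
  \<open>(u\<^sup>2 + v\<^sup>2) / 2\<close> plus terms of lower degree, without a mixed term. The
  double integral therefore splits into an integral over \<open>u\<close> times the conjugate of the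
  same integral over \<open>v\<close>. The phase contributes \<open>- \<i> * p0\<close> to the
  argument of the transform.\<close>

lemma unit_wigner_smooth_x:
  assumes f: "L2_real f"
  shows "(LINT x|lborel. of_real (exp (- (x - x0)\<^sup>2)) *
      (LINT t|lborel. f (x + t / 2) * cnj (f (x - t / 2)) * exp (- (\<i> * of_real (p0 * t)) - (of_real t)\<^sup>2 / 4))) =
    of_real (exp (- x0\<^sup>2) * (norm (bargmann f 1 (Complex x0 (- p0))))\<^sup>2)"
proof -
  have fm[measurable]: "f \<in> borel_measurable borel" using f by (simp add: L2_real_def)
  define H where "H x u = complex_of_real (exp (- (x - x0)\<^sup>2)) * (f u * cnj (f (2 * x - u)) *
      exp (- (\<i> * of_real (p0 * (2 * u - 2 * x))) - (of_real (2 * u - 2 * x))\<^sup>2 / 4))" for x u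
  let ?N = "LINT u|lborel. (norm (f u))\<^sup>2"
  have L: "L2_real (\<lambda>u. cnj (f (2 * x - u)))" for x
    using L2_cnj[OF L2_affine[OF f, of "-1" "2 * x"]] by simp
  have NL: "(LINT u|lborel. (norm (cnj (f (2 * x - u))))\<^sup>2) = ?N" for x
    using lborel_integral_real_affine[of "-1" "\<lambda>t. (norm (f t))\<^sup>2" "2 * x"] by simp
  have iff: "integrable lborel (\<lambda>u. f u * cnj (f (2 * x - u)))" for x
    by (rule L2_mult_integrable[OF f L])
  have Hm: "H x \<in> borel_measurable borel" for x unfolding H_def[abs_def] by measurable
  have nH: "norm (H x u) \<le> exp (- (x - x0)\<^sup>2) * norm (f u * cnj (f (2 * x - u)))" for x u
  proof -
    have "norm (exp (- (\<i> * of_real (p0 * (2 * u - 2 * x))) - (complex_of_real (2 * u - 2 * x))\<^sup>2 / 4)) \<le> 1"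
      by (simp flip: of_real_power of_real_mult of_real_diff of_real_divide)
    then have "norm (f u * cnj (f (2 * x - u))) * norm (exp (- (\<i> * of_real (p0 * (2 * u - 2 * x))) - (complex_of_real (2 * u - 2 * x))\<^sup>2 / 4)) \<le> norm (f u * cnj (f (2 * x - u))) * 1"
      by (intro mult_left_mono) auto
    then show ?thesis unfolding H_def by (simp only: norm_mult) (simp add: mult_left_mono)
  qed
  have iH1: "integrable lborel (H x)" for x
    by (rule Bochner_Integration.integrable_bound[where f="\<lambda>u. exp (- (x - x0)\<^sup>2) *\<^sub>R (f u * cnj (f (2 * x - u)))"])
       (use iff[of x] nH[of x] Hm[of x] in \<open>auto intro!: AE_I2 simp: norm_mult\<close>)
  have mH: "(\<lambda>(x, u). H x u) \<in> borel_measurable (lborel \<Otimes>\<^sub>M lborel)"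
    unfolding H_def by measurable
  have ig: "integrable lborel (\<lambda>x. exp (- (x - x0)\<^sup>2))"
    using integrable_translate[OF gaussian_integrable[of 1 0], of "- x0"] by simp
  have iH: "integrable (lborel \<Otimes>\<^sub>M lborel) (case_prod H)"
  proof (rule lborel_pair.Fubini_integrable[OF mH])
    show "integrable lborel (\<lambda>x. LINT u|lborel. norm (case (x, u) of (x, u) \<Rightarrow> H x u))"
    proof (rule Bochner_Integration.integrable_bound)
      show "integrable lborel (\<lambda>x. exp (- (x - x0)\<^sup>2) * ?N)" using ig by simp
      show "(\<lambda>x. LINT u|lborel. norm (case (x, u) of (x, u) \<Rightarrow> H x u)) \<in> borel_measurable lborel"
        by (intro lborel.borel_measurable_lebesgue_integral) (use mH in measurable)
      show "AE x in lborel. norm (LINT u|lborel. norm (case (x, u) of (x, u) \<Rightarrow> H x u)) \<le> norm (exp (- (x - x0)\<^sup>2) * ?N)"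
      proof (rule AE_I2)
        fix x
        have "(LINT u|lborel. norm (H x u)) \<le> (LINT u|lborel. exp (- (x - x0)\<^sup>2) * norm (f u * cnj (f (2 * x - u))))"
          by (intro integral_mono nH integrable_norm integrable_mult_right iH1 iff)
        also have "\<dots> = exp (- (x - x0)\<^sup>2) * (LINT u|lborel. norm (f u * cnj (f (2 * x - u))))"
          by (rule integral_mult_right_zero)
        also have "\<dots> \<le> exp (- (x - x0)\<^sup>2) * ?N"
          using L2_mult_norm_integral_le[OF f L[of x], of 1] unfolding NL by (intro mult_left_mono) auto
        finally show "norm (LINT u|lborel. norm (case (x, u) of (x, u) \<Rightarrow> H x u)) \<le> norm (exp (- (x - x0)\<^sup>2) * ?N)"
          by simp
      qed
    qed
    show "AE x in lborel. integrable lborel (\<lambda>u. case (x, u) of (x, u) \<Rightarrow> H x u)"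
      using iH1 by simp
  qed
  \<comment> \<open>The change of variables is made one integral at a time: here \<open>t\<close>
    becomes \<open>u\<close> at fixed \<open>x\<close>, with Jacobian 2; after the exchange of
    integrals \<open>x\<close> becomes \<open>v\<close> at fixed \<open>u\<close>, with Jacobian
    1/2.\<close>
  have 1: "of_real (exp (- (x - x0)\<^sup>2)) *
      (LINT t|lborel. f (x + t / 2) * cnj (f (x - t / 2)) * exp (- (\<i> * of_real (p0 * t)) - (of_real t)\<^sup>2 / 4))
     = 2 * (LINT u|lborel. H x u)" for x
  proof -
    have "(LINT t|lborel. f (x + t / 2) * cnj (f (x - t / 2)) * exp (- (\<i> * of_real (p0 * t)) - (of_real t)\<^sup>2 / 4))
      = 2 *\<^sub>R (LINT u|lborel. f u * cnj (f (2 * x - u)) *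
      exp (- (\<i> * of_real (p0 * (2 * u - 2 * x))) - (of_real (2 * u - 2 * x))\<^sup>2 / 4))"
    proof -
      have e: "x + (2 * u - 2 * x) / 2 = u" "x - (2 * u - 2 * x) / 2 = 2 * x - u" "- 2 * x + 2 * u = 2 * u - 2 * x" for u :: real
        by (simp_all add: field_simps)
      show ?thesis
        by (subst lborel_integral_real_affine[of 2 _ "- 2 * x"]) (simp, simp only: e abs_numeral)
    qed
    then show ?thesis unfolding H_def integral_mult_right_zero by (simp add: scaleR_conv_of_real)
  qed
  let ?z = "Complex x0 (- p0)"
  let ?b = "\<lambda>u. f u * (poly 1 (of_real u) * exp (- (1/2) * (of_real u)\<^sup>2 + ?z * of_real u))"
  have 2: "(LINT x|lborel. H x u) = of_real (exp (- x0\<^sup>2)) / 2 * (?b u * cnj (bargmann f 1 ?z))" for u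
  proof -
    have "(LINT x|lborel. H x u) = (1/2) *\<^sub>R (LINT v|lborel. H (u / 2 + 1/2 * v) u)"
      by (subst lborel_integral_real_affine[of "1/2" _ "u / 2"]) simp_all
    also have "(LINT v|lborel. H (u / 2 + 1/2 * v) u) = (LINT v|lborel. of_real (exp (- x0\<^sup>2)) * ?b u * cnj (?b v))"
    proof (rule Bochner_Integration.integral_cong[OF refl])
      fix v :: real
      have a: "2 * (u / 2 + 1 / 2 * v) - u = v" "2 * u - 2 * (u / 2 + 1 / 2 * v) = u - v" by (simp_all add: field_simps)
      have ee: "exp (a + (b + cnj c)) = exp a * (exp b * cnj (exp c))" for a b c :: complex
        by (simp add: exp_add exp_cnj)
      have zc: "?z = of_real x0 - \<i> * of_real p0" by (simp add: complex_eq_iff)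
      have "H (u / 2 + 1/2 * v) u = f u * cnj (f v) * (exp (of_real (- (u / 2 + 1/2 * v - x0)\<^sup>2)) *
        exp (- (\<i> * of_real (p0 * (u - v))) - (of_real (u - v))\<^sup>2 / 4))"
        unfolding H_def a exp_of_real by (simp add: mult_ac)
      also have "\<dots> = f u * cnj (f v) * exp (of_real (- x0\<^sup>2) + ((- (1/2) * (of_real u)\<^sup>2 + ?z * of_real u) + cnj (- (1/2) * (of_real v)\<^sup>2 + ?z * of_real v)))"
        unfolding exp_add[symmetric] zc
        by (rule arg_cong[where f="\<lambda>e. f u * cnj (f v) * exp e"])
           (simp add: power2_eq_square field_simps)
      also have "\<dots> = of_real (exp (- x0\<^sup>2)) * ?b u * cnj (?b v)"
        unfolding ee exp_of_real by (simp only: mult_ac complex_cnj_mult poly_1 mult_1 mult_1_right complex_cnj_one)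
      finally show "H (u / 2 + 1/2 * v) u = of_real (exp (- x0\<^sup>2)) * ?b u * cnj (?b v)" .
    qed
    also have "\<dots> = of_real (exp (- x0\<^sup>2)) * ?b u * cnj (bargmann f 1 ?z)"
      unfolding integral_mult_right_zero Bochner_Integration.integral_cnj bargmann_def ..
    finally show ?thesis by (simp add: scaleR_conv_of_real)
  qed
  have "(LINT x|lborel. of_real (exp (- (x - x0)\<^sup>2)) *
      (LINT t|lborel. f (x + t / 2) * cnj (f (x - t / 2)) * exp (- (\<i> * of_real (p0 * t)) - (of_real t)\<^sup>2 / 4)))
     = 2 * (LINT x|lborel. LINT u|lborel. H x u)"
    unfolding 1 by (rule integral_mult_right_zero)
  also have "(LINT x|lborel. LINT u|lborel. H x u) = (LINT u|lborel. LINT x|lborel. H x u)"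
    by (rule lborel_pair.Fubini_integral[OF iH, symmetric])
  also have "\<dots> = of_real (exp (- x0\<^sup>2)) / 2 * (bargmann f 1 ?z * cnj (bargmann f 1 ?z))"
    unfolding 2 integral_mult_right_zero integral_mult_left_zero bargmann_def ..
  finally show ?thesis by (simp only: of_real_mult complex_norm_square) simp
qed

text \<open>The constant does not depend on the centre. A zero of \<open>bargmann f 1\<close> at
  \<open>x0 - \<i> * p0\<close> therefore makes the average about \<open>(x0, p0)\<close>
  vanish.\<close>

lemma unit_wigner_gauss_eq_bargmann:
  assumes f: "L2_real f"
  shows "\<exists>C::complex. \<forall>x0 p0. (LINT x|lborel. LINT p|lborel. unit_wigner f x p * of_real (exp (- (x - x0)\<^sup>2 - (p - p0)\<^sup>2))) =
    C * of_real (exp (- x0\<^sup>2) * (norm (bargmann f 1 (Complex x0 (- p0))))\<^sup>2)"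
proof -
  obtain C :: complex where C: "\<And>z. (LINT t|lborel. exp (- 1 * (of_real t)\<^sup>2 + z * of_real t)) = C * exp (z\<^sup>2 / (4 * 1))"
    using gaussian_integral[of 1] by auto
  show ?thesis
  proof (intro exI allI)
    fix x0 p0
    have e: "unit_wigner f x p * of_real (exp (- (x - x0)\<^sup>2 - (p - p0)\<^sup>2)) =
      of_real (exp (- (x - x0)\<^sup>2)) * (unit_wigner f x p * of_real (exp (- (p - p0)\<^sup>2)))" for x p
      by (simp add: exp_diff exp_minus field_simps)
    show "(LINT x|lborel. LINT p|lborel. unit_wigner f x p * of_real (exp (- (x - x0)\<^sup>2 - (p - p0)\<^sup>2))) =
    C * of_real (exp (- x0\<^sup>2) * (norm (bargmann f 1 (Complex x0 (- p0))))\<^sup>2)"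
      unfolding e integral_mult_right_zero unit_wigner_smooth_p[OF f C] mult.left_commute[of _ C] unit_wigner_smooth_x[OF f] ..
  qed
qed

section \<open>Nonvanishing of the transform far from the origin\<close>

lemma gauss_plane_integrable:
  "integrable lborel (\<lambda>w :: real \<times> real. exp (- (norm (w - z))\<^sup>2))"
proof -
  obtain a b where z: "z = (a, b)" by (cases z)
  have n: "(norm ((x, y) - z))\<^sup>2 = (x - a)\<^sup>2 + (y - b)\<^sup>2" for x y
    by (simp add: z norm_Pair)
  have i: "integrable lborel (\<lambda>x. exp (- (x - a)\<^sup>2))" for a :: real
    using integrable_translate[OF gaussian_integrable[of 1 0], of "- a"] by simp
  have "integrable (lborel \<Otimes>\<^sub>M lborel) (\<lambda>(x::real, y::real). exp (- (x - a)\<^sup>2) * exp (- (y - b)\<^sup>2))"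
    by (rule lborel_pair.Fubini_integrable) (use i in \<open>auto simp: abs_mult\<close>)
  also have "(\<lambda>(x::real, y::real). exp (- (x - a)\<^sup>2) * exp (- (y - b)\<^sup>2)) = (\<lambda>w. exp (- (norm (w - z))\<^sup>2))"
    unfolding fun_eq_iff split_paired_All prod.case n by (simp add: exp_add[symmetric])
  finally show ?thesis by (simp only: lborel_prod)
qed

text \<open>Nonpositive values of \<open>W\<close> occur only in the disc of radius
  \<open>R\<close>, at distance at least \<open>s = norm z - R\<close> from the centre
  \<open>z\<close>. A unit disc about the point of norm \<open>R + 3\<close> on the ray through
  \<open>z\<close> lies within distance \<open>s - 2\<close> of \<open>z\<close>, and
  \<open>W\<close> has a positive lower bound \<open>m\<close> on the annulus that contains all such
  discs. The two Gaussian weights differ by the factor \<open>exp (4 * s - 4)\<close>, which beats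
  every constant.\<close>

lemma gauss_average_pos:
  fixes W :: "real \<times> real \<Rightarrow> real"
  assumes cont: "continuous_on UNIV W" and B: "\<And>w. \<bar>W w\<bar> \<le> B"
    and pos: "\<And>w. norm w \<ge> R \<Longrightarrow> W w > 0" and R: "R > 0"
  shows "\<exists>R'. \<forall>z. norm z \<ge> R' \<longrightarrow> (LINT w|lborel. W w * exp (- (norm (w - z))\<^sup>2)) > 0"
proof -
  have B0: "B \<ge> 0" using B[of 0] by simp
  have Wm[measurable]: "W \<in> borel_measurable borel" using cont by (rule borel_measurable_continuous_onI)
  let ?K = "cball 0 (R + 4) - ball (0::real \<times> real) (R + 2)"
  have "\<exists>m>0. \<forall>w\<in>?K. m \<le> W w"
  proof (cases "?K = {}")
    case True then show ?thesis by (intro exI[of _ 1]) auto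
  next
    case False
    have "compact ?K" by (intro compact_diff) auto
    then obtain w where w: "w \<in> ?K" "\<And>v. v \<in> ?K \<Longrightarrow> W w \<le> W v"
      using continuous_attains_inf[OF _ False, of W] continuous_on_subset[OF cont] by blast
    then show ?thesis by (intro exI[of _ "W w"]) (auto intro!: pos)
  qed
  then obtain m where m: "m > 0" "\<And>w. w \<in> ?K \<Longrightarrow> m \<le> W w" by blast
  define vR where "vR = measure lborel (ball (0::real \<times> real) R)"
  define v1 where "v1 = measure lborel (ball (0::real \<times> real) 1)"
  have v1: "v1 > 0" unfolding v1_def by (simp add: content_ball_pos)
  have vR: "vR \<ge> 0" by (simp add: vR_def)
  have ball1: "measure lborel (ball c 1) = v1" for c :: "real \<times> real"
    unfolding v1_def by (simp add: content_ball)
  \<comment> \<open>The last summand is the ratio of the worst negative mass to the guaranteed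
    positive one. The exponential factor has to exceed it, for which the linear lower bound of
    \<open>exp\<close> is enough; the summand 4 makes \<open>s - 3\<close> positive.\<close>
  define R' where "R' = R + 4 + B * vR / (m * v1)"
  have q0: "B * vR / (m * v1) \<ge> 0" using B0 vR m v1 by simp
  show ?thesis
  proof (intro exI allI impI)
    fix z :: "real \<times> real" assume z: "norm z \<ge> R'"
    define s where "s = norm z - R"
    have s4: "s \<ge> 4 + B * vR / (m * v1)" using z by (simp add: s_def R'_def)
    then have s: "s \<ge> 4" using q0 by linarith
    have z0: "norm z > 0" using s R unfolding s_def by linarith
    define c where "c = ((R + 3) / norm z) *\<^sub>R z"
    have nc: "norm c = R + 3" using z0 R by (simp add: c_def)
    have "z - c = (1 - (R + 3) / norm z) *\<^sub>R z" by (simp add: c_def algebra_simps)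
    then have "norm (z - c) = \<bar>1 - (R + 3) / norm z\<bar> * norm z" by simp
    also have "\<dots> = \<bar>(1 - (R + 3) / norm z) * norm z\<bar>" by (simp add: abs_mult)
    also have "(1 - (R + 3) / norm z) * norm z = s - 3" using z0 by (simp add: s_def field_simps)
    finally have nzc: "norm (z - c) = s - 3" using s by simp
    let ?E = "\<lambda>w. exp (- (norm (w - z))\<^sup>2)"
    let ?L = "\<lambda>w. m * exp (- (s - 2)\<^sup>2) * indicator (ball c 1) w - B * exp (- s\<^sup>2) * indicator (ball 0 R) w"
    have low: "?L w \<le> W w * ?E w" for w
    proof (cases "norm w < R")
      case True
      have "norm c \<le> norm w + dist c w" using norm_triangle_ineq2[of c w] by (simp add: dist_norm)
      then have nb: "w \<notin> ball c 1" using True nc by auto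
      have "s \<le> norm (w - z)"
        using norm_triangle_ineq2[of z w] True by (simp add: s_def norm_minus_commute)
      then have "s\<^sup>2 \<le> (norm (w - z))\<^sup>2" using s by (intro power_mono) auto
      then have "B * exp (- (norm (w - z))\<^sup>2) \<le> B * exp (- s\<^sup>2)" using B0 by (intro mult_left_mono) auto
      moreover have "- B * ?E w \<le> W w * ?E w"
        using B[of w] by (intro mult_right_mono) auto
      ultimately show ?thesis using nb True by simp
    next
      case False
      then have W0: "W w > 0" using pos by simp
      show ?thesis
      proof (cases "w \<in> ball c 1")
        case True
        then have d: "norm (w - c) < 1" by (simp add: dist_norm norm_minus_commute)
        have "w \<in> ?K"
          using norm_triangle_ineq2[of w c] norm_triangle_ineq2[of c w] d nc by (simp add: norm_minus_commute)
        then have mW: "m \<le> W w" by (rule m(2))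
        have "norm (w - z) \<le> norm (w - c) + norm (z - c)"
          using norm_triangle_ineq4[of "w - c" "z - c"] by simp
        then have "norm (w - z) \<le> s - 2" using d nzc by linarith
        then have "(norm (w - z))\<^sup>2 \<le> (s - 2)\<^sup>2" by (intro power_mono) auto
        then have "m * exp (- (s - 2)\<^sup>2) \<le> W w * ?E w"
          using mW m(1) W0 by (intro mult_mono) auto
        then show ?thesis using True False by simp
      qed (use False W0 in simp)
    qed
    have iE: "integrable lborel ?E" by (rule gauss_plane_integrable)
    have iWE: "integrable lborel (\<lambda>w. W w * ?E w)"
      by (rule Bochner_Integration.integrable_bound[where f="\<lambda>w. B * ?E w"])
         (use iE B B0 in \<open>auto intro!: AE_I2 mult_right_mono simp: abs_mult\<close>)
    have ii: "integrable lborel (indicator (ball c r) :: real \<times> real \<Rightarrow> real)" for c r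
      using emeasure_bounded_finite[OF bounded_ball, of c r] by (simp add: integrable_indicator_iff)
    have "m * exp (- (s - 2)\<^sup>2) * v1 - B * exp (- s\<^sup>2) * vR = (LINT w|lborel. ?L w)"
      using ii[of c 1] ii[of 0 R] by (simp add: ball1 vR_def)
    also have "\<dots> \<le> (LINT w|lborel. W w * ?E w)"
      by (intro integral_mono low iWE Bochner_Integration.integrable_diff integrable_mult_right ii)
    finally have le: "m * exp (- (s - 2)\<^sup>2) * v1 - B * exp (- s\<^sup>2) * vR \<le> (LINT w|lborel. W w * ?E w)" .
    have "B * vR / (m * v1) < exp (4 * s - 4)"
      using exp_ge_add_one_self[of "4 * s - 4"] s4 s by linarith
    then have "B * vR < exp (4 * s - 4) * (m * v1)"
      using m v1 by (simp add: pos_divide_less_eq)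
    then have "B * vR * exp (- s\<^sup>2) < exp (4 * s - 4) * (m * v1) * exp (- s\<^sup>2)"
      by simp
    also have "\<dots> = m * v1 * (exp (4 * s - 4) * exp (- s\<^sup>2))" by simp
    also have "exp (4 * s - 4) * exp (- s\<^sup>2) = exp (- (s - 2)\<^sup>2)"
      by (simp add: exp_add[symmetric] power2_eq_square algebra_simps)
    finally show "(LINT w|lborel. W w * ?E w) > 0" using le by (simp add: mult_ac)
  qed
qed

lemma bargmann_nonzero:
  assumes f: "L2_real f" and bd: "bounded {z. unit_wigner f (fst z) (snd z) = 0}"
  shows "\<exists>R'. \<forall>z. norm z \<ge> R' \<longrightarrow> bargmann f 1 z \<noteq> 0"
proof -
  define W where "W w = Re (unit_wigner f (fst w) (snd w))" for w
  have Ww: "unit_wigner f (fst w) (snd w) = of_real (W w)" for w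
    using unit_wigner_real[OF f, of "fst w" "snd w"] by (simp add: W_def)
  have cW: "continuous_on UNIV W"
    unfolding W_def[abs_def] by (intro continuous_intros unit_wigner_continuous[OF f])
  define B where "B = 2 * (LINT t|lborel. (norm (f t))\<^sup>2)"
  have B: "\<bar>W w\<bar> \<le> B" for w
    using norm_unit_wigner_le[OF f, of "fst w" "snd w"] unfolding Ww B_def by simp
  obtain R where R: "R > 0" "\<And>w. unit_wigner f (fst w) (snd w) = 0 \<Longrightarrow> norm w < R"
    using bd by (auto simp: bounded_pos_less)
  \<comment> \<open>The exterior of a disc is connected because the plane has dimension two; this
    forbids a change of sign without a zero.\<close>
  have conn: "connected (- ball (0::real \<times> real) R)"
    by (rule connected_complement_bounded_convex) auto
  have nz: "W w \<noteq> 0" if "w \<in> - ball 0 R" for w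
    using R(2)[of w] that unfolding Ww by auto
  have c: "connected (W ` (- ball 0 R))"
    by (rule connected_continuous_image[OF continuous_on_subset[OF cW] conn]) simp
  have "\<exists>s\<in>{1, -1}. \<forall>w\<in>- ball 0 R. s * W w > 0"
  proof (rule ccontr)
    assume "\<not> ?thesis"
    then obtain v w where vw: "v \<in> - ball 0 R" "w \<in> - ball 0 R" "W v \<le> 0" "W w \<ge> 0" by force
    then have "0 \<in> W ` (- ball 0 R)"
      using connectedD_interval[OF c, of "W v" "W w" 0] by auto
    then show False using nz by force
  qed
  then obtain \<sigma> where \<sigma>: "\<sigma> = 1 \<or> \<sigma> = -1" "\<And>w. norm w \<ge> R \<Longrightarrow> \<sigma> * W w > 0" by force
  obtain R' where R': "\<And>z. norm z \<ge> R' \<Longrightarrow> (LINT w|lborel. (\<sigma> * W w) * exp (- (norm (w - z))\<^sup>2)) > 0"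
  proof -
    have "\<exists>R'. \<forall>z. norm z \<ge> R' \<longrightarrow> (LINT w|lborel. (\<sigma> * W w) * exp (- (norm (w - z))\<^sup>2)) > 0"
    proof (rule gauss_average_pos[OF _ _ \<sigma>(2) R(1)])
      show "continuous_on UNIV (\<lambda>w. \<sigma> * W w)" by (intro continuous_intros cW)
      show "\<bar>\<sigma> * W w\<bar> \<le> B" for w using B[of w] \<sigma>(1) by auto
    qed
    then show ?thesis using that by blast
  qed
  obtain C :: complex where C: "\<And>x0 p0. (LINT x|lborel. LINT p|lborel. unit_wigner f x p * of_real (exp (- (x - x0)\<^sup>2 - (p - p0)\<^sup>2))) =
    C * of_real (exp (- x0\<^sup>2) * (norm (bargmann f 1 (Complex x0 (- p0))))\<^sup>2)"
    using unit_wigner_gauss_eq_bargmann[OF f] by blast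
  show ?thesis
  proof (intro exI allI impI notI)
    fix z :: complex assume z: "norm z \<ge> R'" and b: "bargmann f 1 z = 0"
    \<comment> \<open>The second coordinate is \<open>- Im z\<close> because the transform is
      evaluated at \<open>x0 - \<i> * p0\<close>.\<close>
    let ?w = "(Re z, - Im z)"
    have nw: "norm ?w = norm z" by (simp add: norm_Pair cmod_def)
    have Wm[measurable]: "W \<in> borel_measurable borel" using cW by (rule borel_measurable_continuous_onI)
    have iWE: "integrable lborel (\<lambda>w. W w * exp (- (norm (w - ?w))\<^sup>2))"
      by (rule Bochner_Integration.integrable_bound[where f="\<lambda>w. B * exp (- (norm (w - ?w))\<^sup>2)"])
         (use gauss_plane_integrable[of ?w] B in \<open>auto intro!: AE_I2 mult_right_mono simp: abs_mult intro: order_trans[OF _ abs_ge_self]\<close>)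
    have "complex_of_real (LINT w|lborel. W w * exp (- (norm (w - ?w))\<^sup>2)) =
      of_real (LINT x|lborel. LINT p|lborel. W (x, p) * exp (- (norm ((x, p) - ?w))\<^sup>2))"
      using lborel_pair.integral_fst'[of "\<lambda>w. W w * exp (- (norm (w - ?w))\<^sup>2)"] iWE by (simp add: lborel_prod)
    also have "\<dots> = (LINT x|lborel. LINT p|lborel. of_real (W (x, p) * exp (- (norm ((x, p) - ?w))\<^sup>2)))"
      by (simp only: integral_complex_of_real)
    also have "\<dots> = (LINT x|lborel. LINT p|lborel. unit_wigner f x p * of_real (exp (- (x - Re z)\<^sup>2 - (p - (- Im z))\<^sup>2)))"
    proof -
      have "complex_of_real (W (x, p) * exp (- (norm ((x, p) - ?w))\<^sup>2)) = unit_wigner f x p * of_real (exp (- (x - Re z)\<^sup>2 - (p - (- Im z))\<^sup>2))" for x p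
        using Ww[of "(x, p)"] by (simp add: norm_Pair)
      then show ?thesis by (simp only:)
    qed
    also have "\<dots> = 0" unfolding C using b by simp
    finally have "(LINT w|lborel. W w * exp (- (norm (w - ?w))\<^sup>2)) = 0" by simp
    then show False using R'[of ?w] z nw by (simp add: mult.assoc)
  qed
qed

section \<open>Entire functions of order two with finitely many zeros\<close>

text \<open>A Borel-Caratheodory argument: a one-sided bound on the real part in a disc controls the
  modulus in the disc of half the radius, so \<open>g\<close> has at most quadratic growth and
  Liouville's theorem for polynomials applies.\<close>

lemma entire_Re_quadratic_growth:
  assumes hol: "g holomorphic_on UNIV" and le: "\<And>z. Re (g z) \<le> A + B * (norm z)\<^sup>2"
    and AB: "A \<ge> 0" "B \<ge> 0"
  obtains a b c where "\<And>z. g z = a + b * z + c * z\<^sup>2"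
proof -
  define g0 where "g0 z = g z - g 0" for z
  have hol0: "g0 holomorphic_on UNIV" unfolding g0_def by (intro holomorphic_intros hol)
  define K where "K = A + \<bar>Re (g 0)\<bar> + 1"
  have K: "K > 0" using AB by (simp add: K_def)
  have bound0: "norm (g0 z) \<le> 2 * (K + 4 * B * (norm z)\<^sup>2)" if z: "norm z \<ge> 1" for z
  proof -
    define R where "R = 2 * norm z"
    have R: "R > 0" using z by (auto simp: R_def)
    define M where "M = K + B * R\<^sup>2"
    have M: "M > 0" using K AB by (simp add: M_def add_pos_nonneg)
    have ReM: "Re (g0 (of_real R * w)) < M" if w: "norm w < 1" for w
    proof -
      have "norm (of_real R * w) \<le> R" using w R by (simp add: norm_mult mult_left_le)
      then have "B * (norm (of_real R * w))\<^sup>2 \<le> B * R\<^sup>2" using AB by (intro mult_left_mono power_mono) auto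
      then show ?thesis using le[of "of_real R * w"] by (simp add: g0_def M_def K_def)
    qed
    \<comment> \<open>The Moebius map behind \<open>h\<close> sends the half plane of real parts
      below \<open>M\<close> into the unit disc and fixes 0, so the Schwarz lemma applies; the point
      \<open>z\<close> corresponds to modulus 1/2. Solving the resulting inequality for
      \<open>g0 z\<close> gives the bound \<open>2 * M\<close>.\<close>
    define h where "h w = g0 (of_real R * w) / (2 * of_real M - g0 (of_real R * w))" for w
    have dz: "2 * of_real M - g0 (of_real R * w) \<noteq> 0" if w: "norm w < 1" for w
    proof
      assume "2 * of_real M - g0 (of_real R * w) = 0"
      then have "Re (g0 (of_real R * w)) = 2 * M"
        by (metis Re_complex_of_real eq_iff_diff_eq_0 of_real_mult of_real_numeral)
      then show False using ReM[OF w] M by simp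
    qed
    have hh: "h holomorphic_on ball 0 1"
      unfolding h_def
      by (intro holomorphic_intros holomorphic_on_compose_gen[OF _ hol0, unfolded o_def]) (use dz in auto)
    have hlt: "norm (h w) < 1" if w: "norm w < 1" for w
    proof -
      let ?q = "g0 (of_real R * w)"
      have "(norm (2 * of_real M - ?q))\<^sup>2 - (norm ?q)\<^sup>2 = 4 * M * (M - Re ?q)"
        unfolding cmod_power2 by (simp add: power2_eq_square algebra_simps)
      also have "\<dots> > 0" using M ReM[OF w] by simp
      finally have "(norm ?q)\<^sup>2 < (norm (2 * of_real M - ?q))\<^sup>2" by simp
      then have "norm ?q < norm (2 * of_real M - ?q)" by (rule power2_less_imp_less) simp
      then show ?thesis using dz[OF w] by (simp add: h_def norm_divide divide_less_eq)
    qed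
    let ?w = "z / of_real R"
    have w: "norm ?w = 1/2" using z by (auto simp: norm_divide R_def)
    have Rw: "of_real R * ?w = z" using R by simp
    have "h 0 = 0" by (simp add: h_def g0_def)
    then have "norm (h ?w) \<le> norm ?w"
      by (intro Schwarz_Lemma(1)[OF hh]) (use hlt w in auto)
    then have "norm (h ?w) \<le> 1/2" unfolding w .
    then have "norm (g0 z) / norm (2 * of_real M - g0 z) \<le> 1/2"
      unfolding h_def Rw norm_divide .
    then have "norm (g0 z) \<le> 1/2 * norm (2 * of_real M - g0 z)"
      using dz[of ?w] w unfolding Rw by (simp add: pos_divide_le_eq)
    also have "\<dots> \<le> 1/2 * (2 * M + norm (g0 z))"
      using norm_triangle_ineq4[of "2 * of_real M" "g0 z"] M by simp
    finally have "norm (g0 z) \<le> 2 * M" by simp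
    then show ?thesis by (simp add: M_def R_def power_mult_distrib mult_ac)
  qed
  have "norm (g z) \<le> (norm (g 0) + 2 * K + 8 * B) * norm z ^ 2" if z: "1 \<le> norm z" for z
  proof -
    have z2: "1 \<le> (norm z)\<^sup>2" using z by simp
    have "norm (g z) \<le> norm (g 0) + norm (g0 z)"
      using norm_triangle_ineq[of "g 0" "g0 z"] by (simp add: g0_def)
    also have "\<dots> \<le> (norm (g 0) + 2 * K) * 1 + 8 * B * (norm z)\<^sup>2" using bound0[OF z] by simp
    also have "\<dots> \<le> (norm (g 0) + 2 * K) * (norm z)\<^sup>2 + 8 * B * (norm z)\<^sup>2"
      using K by (intro add_right_mono mult_left_mono z2) auto
    finally show ?thesis by (simp add: algebra_simps)
  qed
  from Liouville_polynomial[OF hol this]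
  have sum: "g z = (\<Sum>k\<le>2. (deriv ^^ k) g 0 / fact k * z ^ k)" for z by blast
  have "g z = (deriv ^^ 0) g 0 / fact 0 + (deriv ^^ 1) g 0 / fact 1 * z + (deriv ^^ 2) g 0 / fact 2 * z\<^sup>2" for z
  proof -
    have "{..2::nat} = {0, 1, 2}" by auto
    then show ?thesis by (subst sum) (simp del: funpow.simps)
  qed
  then show ?thesis by (rule that)
qed

text \<open>Each zero is divided out with its full order. The quotient takes its value at
  \<open>a\<close> from the local factorisation, which makes it entire and nonzero there, so its
  zero set has lost exactly \<open>a\<close>.\<close>

lemma entire_factor_finite_zeros:
  assumes "finite Z" "F holomorphic_on UNIV" "{z. F z = 0} = Z"
  shows "\<exists>P G. P \<noteq> 0 \<and> G holomorphic_on UNIV \<and> (\<forall>z. G z \<noteq> 0) \<and> (\<forall>z. F z = poly P z * G z)"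
  using assms
proof (induction Z arbitrary: F rule: finite_induct)
  case empty
  then show ?case by (intro exI[of _ 1] exI[of _ F]) auto
next
  case (insert a Z)
  have Fa: "F a = 0" using insert.prems by auto
  have nc: "\<not> F constant_on UNIV"
  proof
    assume "F constant_on UNIV"
    then have "{z. F z = 0} = UNIV" using Fa by (auto simp: constant_on_def)
    then show False using insert by (metis finite.insertI infinite_UNIV_char_0)
  qed
  obtain g r n where g: "0 < n" "0 < r" "g holomorphic_on ball a r"
      "\<And>w. w \<in> ball a r \<Longrightarrow> F w = (w - a) ^ n * g w" "\<And>w. w \<in> ball a r \<Longrightarrow> g w \<noteq> 0"
    by (rule holomorphic_factor_zero_nonconstant[OF insert.prems(1) open_UNIV connected_UNIV UNIV_I Fa]) (use nc in auto)
  define H where "H z = (if z = a then g a else F z / (z - a) ^ n)" for z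
  have H: "F z = (z - a) ^ n * H z" for z using Fa g(1) by (simp add: H_def)
  have "H holomorphic_on ball a r \<union> (- {a})"
  proof (rule holomorphic_on_Un)
    show "H holomorphic_on ball a r"
      using g(3) by (rule holomorphic_transform) (use g(4) in \<open>auto simp: H_def\<close>)
    have "(\<lambda>z. F z / (z - a) ^ n) holomorphic_on - {a}"
      by (intro holomorphic_intros holomorphic_on_subset[OF insert.prems(1)]) auto
    then show "H holomorphic_on - {a}"
      by (rule holomorphic_transform) (auto simp: H_def)
  qed auto
  moreover have "ball a r \<union> (- {a}) = UNIV" using g(2) by auto
  ultimately have hH: "H holomorphic_on UNIV" by simp
  have Ha: "H a \<noteq> 0" using g(2) g(5)[of a] by (simp add: H_def)
  have "{z. H z = 0} = Z"
  proof -
    have "H z = 0 \<longleftrightarrow> F z = 0 \<and> z \<noteq> a" for z using H[of z] Ha g(1) by auto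
    then show ?thesis using insert.prems(2) insert.hyps by auto
  qed
  from insert.IH[OF hH this] obtain P G where PG: "P \<noteq> 0" "G holomorphic_on UNIV" "\<And>z. G z \<noteq> 0" "\<And>z. H z = poly P z * G z"
    by auto
  show ?case
    by (intro exI[of _ "[:- a, 1:] ^ n * P"] exI[of _ G]) (use PG H in auto)
qed

lemma poly_lower_bound_at_infinity:
  fixes P :: "complex poly"
  assumes "P \<noteq> 0"
  obtains \<delta> R where "\<delta> > 0" "R > 0" "\<And>z. norm z \<ge> R \<Longrightarrow> norm (poly P z) \<ge> \<delta>"
proof (cases P)
  case (pCons a p)
  show ?thesis
  proof (cases "p = 0")
    case True
    then show ?thesis using assms pCons by (intro that[of "norm a" 1]) auto
  next
    case False
    from poly_infinity[OF this, of 1 a] obtain r where "\<And>z. r \<le> norm z \<Longrightarrow> 1 \<le> norm (poly (pCons a p) z)" by auto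
    then show ?thesis using pCons by (intro that[of 1 "max r 1"]) auto
  qed
qed

text \<open>Dividing out the finitely many zeros leaves a zero-free function with an entire
  logarithm \<open>g\<close>. The division preserves the growth bound, because the polynomial is
  bounded away from 0 outside a disc; inside the disc continuity bounds
  \<open>Re (g z)\<close>.\<close>

lemma entire_order2_finite_zeros:
  assumes hol: "F holomorphic_on UNIV" and nz: "\<And>z. norm z \<ge> R0 \<Longrightarrow> F z \<noteq> 0"
    and bd: "\<And>z. norm (F z) \<le> B * exp ((norm z)\<^sup>2)"
  obtains P \<alpha> \<beta> where "P \<noteq> 0" "\<And>z. F z = poly P z * exp (\<alpha> * z\<^sup>2 + \<beta> * z)"
proof -
  have sub: "{z. F z = 0} \<subseteq> cball 0 R0" using nz by (force simp: not_le[symmetric])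
  have fin: "finite {z. F z = 0}"
  proof (cases "F constant_on UNIV")
    case True
    have "F (of_real \<bar>R0\<bar>) \<noteq> 0" by (rule nz) simp
    then have "{z. F z = 0} = {}" using True by (auto simp: constant_on_def)
    then show ?thesis by simp
  next
    case False
    have "finite {z \<in> cball 0 R0. F z = 0}"
      by (rule holomorphic_compact_finite_zeros[OF hol]) (use False in auto)
    also have "{z \<in> cball 0 R0. F z = 0} = {z. F z = 0}" using sub by auto
    finally show ?thesis .
  qed
  obtain P G where PG: "P \<noteq> 0" "G holomorphic_on UNIV" "\<And>z. G z \<noteq> 0" "\<And>z. F z = poly P z * G z"
    using entire_factor_finite_zeros[OF fin hol refl] by auto
  obtain g where g: "g holomorphic_on UNIV" "\<And>z. exp (g z) = G z"
    using holomorphic_logarithm_exists[of UNIV G 0] PG by auto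
  obtain \<delta> R where \<delta>: "\<delta> > 0" "R > 0" "\<And>z. norm z \<ge> R \<Longrightarrow> norm (poly P z) \<ge> \<delta>"
    using poly_lower_bound_at_infinity[OF PG(1)] by blast
  have B: "B > 0"
  proof -
    have "0 < norm (F (of_real \<bar>R0\<bar>))" using nz[of "of_real \<bar>R0\<bar>"] by simp
    also have "\<dots> \<le> B * exp ((norm (complex_of_real \<bar>R0\<bar>))\<^sup>2)" by (rule bd)
    finally show ?thesis by (simp add: zero_less_mult_iff)
  qed
  have out: "Re (g z) \<le> ln (B / \<delta>) + (norm z)\<^sup>2" if z: "norm z \<ge> R" for z
  proof -
    have "\<delta> * exp (Re (g z)) \<le> norm (poly P z) * norm (G z)"
      unfolding g(2)[symmetric] norm_exp_eq_Re by (intro mult_right_mono \<delta>(3) z) simp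
    also have "\<dots> = norm (F z)" by (simp add: PG(4) norm_mult)
    also have "\<dots> \<le> B * exp ((norm z)\<^sup>2)" by (rule bd)
    finally have "exp (Re (g z)) \<le> (B / \<delta>) * exp ((norm z)\<^sup>2)" using \<delta>(1) by (simp add: field_simps)
    also have "\<dots> = exp (ln (B / \<delta>) + (norm z)\<^sup>2)" using B \<delta>(1) by (simp add: exp_add)
    finally show ?thesis by simp
  qed
  have "compact ((\<lambda>z. Re (g z)) ` cball 0 R)"
    by (intro compact_continuous_image continuous_intros holomorphic_on_imp_continuous_on
          holomorphic_on_subset[OF g(1)]) auto
  then have "bounded ((\<lambda>z. Re (g z)) ` cball 0 R)" by (rule compact_imp_bounded)
  then obtain K where K: "\<And>z. norm z \<le> R \<Longrightarrow> \<bar>Re (g z)\<bar> \<le> K" by (force simp: bounded_iff)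
  have all: "Re (g z) \<le> (\<bar>ln (B / \<delta>)\<bar> + \<bar>K\<bar>) + 1 * (norm z)\<^sup>2" for z
  proof (cases "norm z \<ge> R")
    case True then show ?thesis using out[of z] by simp
  next
    case False
    then have "Re (g z) \<le> \<bar>K\<bar>" using K[of z] by simp
    then show ?thesis by (simp add: add_increasing add_increasing2)
  qed
  obtain a b c where abc: "\<And>z. g z = a + b * z + c * z\<^sup>2"
    by (rule entire_Re_quadratic_growth[OF g(1) all]) auto
  show ?thesis
  proof (rule that[of "smult (exp a) P" c b])
    show "smult (exp a) P \<noteq> 0" using PG(1) by simp
    show "F z = poly (smult (exp a) P) z * exp (c * z\<^sup>2 + b * z)" for z
      by (simp add: PG(4) g(2)[symmetric] abc exp_add)
  qed
qed

section \<open>Bounded nodal sets\<close>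

lemma quadratic_unbounded_above:
  fixes a b c R :: real
  assumes "a > 0" "\<And>y. y \<ge> R \<Longrightarrow> a * y\<^sup>2 + b * y \<le> c"
  shows False
proof -
  define y where "y = max R (max 1 ((\<bar>b\<bar> + \<bar>c\<bar> + 1) / a))"
  have y: "y \<ge> R" "y \<ge> 1" "y \<ge> (\<bar>b\<bar> + \<bar>c\<bar> + 1) / a" by (auto simp: y_def)
  have "a * y \<ge> \<bar>b\<bar> + \<bar>c\<bar> + 1" using y(3) assms(1) by (simp add: pos_divide_le_eq mult.commute)
  then have "a * y + b \<ge> \<bar>c\<bar> + 1" by linarith
  then have "1 * (\<bar>c\<bar> + 1) \<le> y * (a * y + b)" using y(2) by (intro mult_mono) auto
  also have "\<dots> = a * y\<^sup>2 + b * y" by (simp add: power2_eq_square algebra_simps)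
  also have "\<dots> \<le> c" using assms(2)[OF y(1)] .
  finally show False by simp
qed

text \<open>A shift of \<open>z\<close> by \<open>\<i> * y\<close> is a Fourier character in
  \<open>u\<close>. Along vertical lines the transform is thus an ordinary Fourier transform, to
  which \<open>Fourier_injective\<close> applies.\<close>

lemma exp_quadratic_split:
  "exp (- g * (complex_of_real u)\<^sup>2 + (z + \<i> * of_real y) * of_real u) =
    exp (- g * (of_real u)\<^sup>2 + z * of_real u) * iexp (y * u)"
  unfolding exp_add[symmetric] by (rule arg_cong[where f=exp]) (simp add: algebra_simps)

text \<open>Applying \<open>d/dz - \<beta>\<close> multiplies the weight by \<open>u - \<beta>\<close> and differentiates \<open>P\<close>, so finitely many
  applications annihilate the transform.\<close>

lemma bargmann_exponential_imp_AE_0: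
  assumes f: "L2_real f"
  shows "\<lbrakk>P = 0 \<or> degree P < n; r \<noteq> 0; \<And>z. bargmann f r z = poly P z * exp (\<beta> * z)\<rbrakk> \<Longrightarrow> AE u in lborel. f u = 0"
proof (induction n arbitrary: P r)
  case 0
  then have z: "bargmann f r z = 0" for z by simp
  let ?e = "\<lambda>z u. poly r (of_real u) * exp (- (1/2) * (complex_of_real u)\<^sup>2 + z * of_real u)"
  have "AE u in lborel. f u * ?e 0 u = 0"
  proof (rule Fourier_injective)
    show "integrable lborel (\<lambda>u. f u * ?e 0 u)" by (rule bargmann_integrable[OF f])
    fix y
    have "(LINT u|lborel. f u * ?e 0 u * iexp (y * u)) = bargmann f r (0 + \<i> * of_real y)"
      unfolding bargmann_def exp_quadratic_split by (simp only: mult.assoc)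
    then show "(LINT u|lborel. f u * ?e 0 u * iexp (y * u)) = 0" by (simp only: z)
  qed
  \<comment> \<open>The polynomial \<open>r\<close> is nonzero but may vanish at real points; these
    are finitely many and hence negligible, so \<open>f\<close> itself vanishes almost
    everywhere.\<close>
  moreover have "AE u in lborel. u \<notin> {u::real. poly r (of_real u) = 0}"
  proof (rule AE_not_in)
    have "{u::real. poly r (of_real u) = 0} = complex_of_real -` {z. poly r z = 0}" by auto
    also have "finite \<dots>" using poly_roots_finite[OF \<open>r \<noteq> 0\<close>] by (intro finite_vimageI) (auto simp: inj_on_def)
    finally show "{u::real. poly r (of_real u) = 0} \<in> null_sets lborel" by (rule finite_imp_null_set_lborel)
  qed
  ultimately show ?case by eventually_elim auto
next
  case (Suc n)
  let ?r = "pCons 0 r + smult (- \<beta>) r"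
  have r: "?r \<noteq> 0"
  proof -
    have "?r = [:- \<beta>, 1:] * r" by simp
    then show ?thesis using Suc.prems(2) by (metis mult_eq_0_iff pCons_eq_0_iff one_neq_zero)
  qed
  have "bargmann f ?r z = poly (pderiv P) z * exp (\<beta> * z)" for z
  proof -
    have "(bargmann f r has_field_derivative bargmann f (pCons 0 r) z) (at z)"
      by (rule bargmann_has_field_derivative[OF f])
    moreover have "(bargmann f r has_field_derivative (poly (pderiv P) z + \<beta> * poly P z) * exp (\<beta> * z)) (at z)"
      unfolding Suc.prems(3)[abs_def]
      by (rule derivative_eq_intros poly_DERIV refl | simp)+ (simp add: algebra_simps)
    ultimately have "bargmann f (pCons 0 r) z = (poly (pderiv P) z + \<beta> * poly P z) * exp (\<beta> * z)"
      by (rule DERIV_unique)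
    moreover have "bargmann f ?r z = bargmann f (pCons 0 r) z - \<beta> * bargmann f r z"
    proof -
      have "bargmann f ?r z = (LINT u|lborel. f u * (poly (pCons 0 r) (of_real u) * exp (- (1/2) * (of_real u)\<^sup>2 + z * of_real u))
         - \<beta> * (f u * (poly r (of_real u) * exp (- (1/2) * (of_real u)\<^sup>2 + z * of_real u))))"
        unfolding bargmann_def by (intro Bochner_Integration.integral_cong) (simp_all add: algebra_simps)
      also have "\<dots> = bargmann f (pCons 0 r) z - \<beta> * bargmann f r z"
        unfolding bargmann_def
        by (subst Bochner_Integration.integral_diff[OF bargmann_integrable[OF f] integrable_mult_right[OF bargmann_integrable[OF f]]])
           (simp only: integral_mult_right_zero)
      finally show ?thesis .
    qed
    ultimately show ?thesis by (simp add: Suc.prems(3) algebra_simps)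
  qed
  moreover have "pderiv P = 0 \<or> degree (pderiv P) < n"
    using Suc.prems(1) by (cases "degree P = 0") (auto simp: pderiv_eq_0_iff degree_pderiv)
  ultimately show ?case using Suc.IH r by blast
qed

text \<open>At points with large imaginary part \<open>y\<close> the exponent is compared with the
  bound \<open>exp ((Re z)\<^sup>2 / 2)\<close>, which does not grow in \<open>y\<close>. A negative
  \<open>Re \<alpha>\<close> produces quadratic growth in \<open>y\<close>, a nonzero imaginary
  \<open>\<alpha>\<close> linear growth once the real coordinate is chosen well, and
  \<open>\<alpha> = 0\<close> makes \<open>f\<close> vanish almost everywhere, contrary to
  \<open>P \<noteq> 0\<close>.\<close>

lemma bargmann_exponent:
  assumes f: "L2_real f" and P: "P \<noteq> 0" and eq: "\<And>z. bargmann f 1 z = poly P z * exp (\<alpha> * z\<^sup>2 + \<beta> * z)"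
  shows "Re \<alpha> > 0"
proof -
  obtain B where B: "\<And>z. norm (bargmann f 1 z) \<le> B * exp ((Re z)\<^sup>2 / 2)" using norm_bargmann_le[OF f] by blast
  obtain \<delta> R where \<delta>: "\<delta> > 0" "R > 0" "\<And>z. norm z \<ge> R \<Longrightarrow> norm (poly P z) \<ge> \<delta>"
    using poly_lower_bound_at_infinity[OF P] by blast
  have key: "Re \<alpha> * (x\<^sup>2 - y\<^sup>2) - 2 * Im \<alpha> * x * y + Re \<beta> * x - Im \<beta> * y \<le> ln (B / \<delta>) + x\<^sup>2 / 2"
    if y: "y \<ge> R" for x y
  proof -
    let ?z = "Complex x y"
    have "norm ?z \<ge> R" using abs_Im_le_cmod[of ?z] y by simp
    then have "\<delta> * norm (exp (\<alpha> * ?z\<^sup>2 + \<beta> * ?z)) \<le> norm (bargmann f 1 ?z)"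
      unfolding eq norm_mult by (intro mult_right_mono \<delta>(3)) auto
    also have "\<dots> \<le> B * exp (x\<^sup>2 / 2)" using B[of ?z] by simp
    finally have 1: "\<delta> * norm (exp (\<alpha> * ?z\<^sup>2 + \<beta> * ?z)) \<le> B * exp (x\<^sup>2 / 2)" .
    have "0 < \<delta> * norm (exp (\<alpha> * ?z\<^sup>2 + \<beta> * ?z))" using \<delta>(1) by simp
    then have "0 < B * exp (x\<^sup>2 / 2)" using 1 by linarith
    then have B0: "B > 0" by (simp add: zero_less_mult_iff)
    have "exp (Re (\<alpha> * ?z\<^sup>2 + \<beta> * ?z)) \<le> (B / \<delta>) * exp (x\<^sup>2 / 2)"
      using 1 \<delta>(1) by (simp add: field_simps)
    also have "\<dots> = exp (ln (B / \<delta>) + x\<^sup>2 / 2)" using B0 \<delta>(1) by (simp add: exp_add)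
    finally have "Re (\<alpha> * ?z\<^sup>2 + \<beta> * ?z) \<le> ln (B / \<delta>) + x\<^sup>2 / 2" by simp
    moreover have "Re (\<alpha> * ?z\<^sup>2 + \<beta> * ?z) = Re \<alpha> * (x\<^sup>2 - y\<^sup>2) - 2 * Im \<alpha> * x * y + Re \<beta> * x - Im \<beta> * y"
      by (simp add: power2_eq_square algebra_simps)
    ultimately show ?thesis by simp
  qed
  show ?thesis
  proof (rule ccontr)
    assume "\<not> Re \<alpha> > 0"
    then consider "Re \<alpha> < 0" | "Re \<alpha> = 0" "Im \<alpha> \<noteq> 0" | "\<alpha> = 0"
      by (force simp: complex_eq_iff)
    then show False
    proof cases
      case 1
      show False
      proof (rule quadratic_unbounded_above[of "- Re \<alpha>" R "- Im \<beta>" "ln (B / \<delta>)"])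
        show "- Re \<alpha> > 0" using 1 by simp
        show "- Re \<alpha> * y\<^sup>2 + - Im \<beta> * y \<le> ln (B / \<delta>)" if "y \<ge> R" for y
          using key[OF that, of 0] by simp
      qed
    next
      case 2
      \<comment> \<open>Chosen so that the coefficient of \<open>y\<close> in the real part of the
        exponent equals 1.\<close>
      define x where "x = - (1 + Im \<beta>) / (2 * Im \<alpha>)"
      have x: "- 2 * Im \<alpha> * x - Im \<beta> = 1" using 2 by (simp add: x_def field_simps)
      define y where "y = max R (ln (B / \<delta>) + x\<^sup>2 / 2 - Re \<beta> * x + 1)"
      have "Re \<beta> * x + (- 2 * Im \<alpha> * x - Im \<beta>) * y \<le> ln (B / \<delta>) + x\<^sup>2 / 2"
        using key[of y x] 2 by (simp add: y_def algebra_simps)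
      then have "Re \<beta> * x + y \<le> ln (B / \<delta>) + x\<^sup>2 / 2" unfolding x by simp
      moreover have "y \<ge> ln (B / \<delta>) + x\<^sup>2 / 2 - Re \<beta> * x + 1" by (simp add: y_def)
      ultimately show False by linarith
    next
      case 3
      have "AE u in lborel. f u = 0"
        by (rule bargmann_exponential_imp_AE_0[OF f, of P "Suc (degree P)" 1 \<beta>]) (use eq 3 in auto)
      then have "AE u in lborel. f u * (poly 1 (of_real u) * exp (- (1/2) * (of_real u)\<^sup>2 + z * of_real u)) = 0" for z :: complex
        by eventually_elim simp
      then have "bargmann f 1 z = 0" for z
        unfolding bargmann_def by (rule integral_eq_zero_AE)
      then have "poly P z = 0" for z using eq[of z] by simp
      then show False using P poly_eq_poly_eq_iff[of P 0] by (simp add: fun_eq_iff)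
    qed
  qed
qed

lemma integrable_not_bounded_below_halfline:
  fixes g :: "real \<Rightarrow> real"
  assumes g: "integrable lborel g" "\<And>t. g t \<ge> 0" and e: "e > 0"
    and low: "AE t in lborel. t \<ge> R \<longrightarrow> g t \<ge> e"
  shows False
proof -
  define I where "I = (LINT t|lborel. g t)"
  define n where "n = (\<bar>I\<bar> + 1) / e"
  have n: "n \<ge> 0" "e * n = \<bar>I\<bar> + 1" using e by (auto simp: n_def)
  have "e * n = (LINT t|lborel. e * indicator {R..R+n} t)" using n by simp
  also have "\<dots> \<le> I"
    unfolding I_def
  proof (rule integral_mono_AE[OF _ g(1)])
    show "integrable lborel (\<lambda>t. e * indicator {R..R+n} t)"
      by (intro integrable_mult_right) (simp add: integrable_indicator_iff emeasure_lborel_Icc_eq)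
    show "AE t in lborel. e * indicator {R..R+n} t \<le> g t"
      using low by eventually_elim (use g(2) in \<open>auto split: split_indicator\<close>)
  qed
  finally show False using n by linarith
qed

text \<open>If \<open>Re \<eta> \<le> 0\<close>, the exponential has modulus at least 1 on the half
  line where \<open>Re \<delta> * u\<close> is nonnegative, while the polynomial is bounded away
  from 0 far out. The squared modulus of \<open>f\<close> would then have a positive lower bound
  almost everywhere on a half line, against its integrability.\<close>

lemma poly_gauss_L2_exponent:
  assumes f: "L2_real f" and r: "r \<noteq> 0"
    and eq: "AE u in lborel. f u = poly r (of_real u) * exp (- \<eta> * (of_real u)\<^sup>2 + \<delta> * of_real u)"
  shows "Re \<eta> > 0"
proof (rule ccontr)
  assume n: "\<not> Re \<eta> > 0"
  obtain d R where d: "d > 0" "R > 0" "\<And>z. norm z \<ge> R \<Longrightarrow> norm (poly r z) \<ge> d"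
    using poly_lower_bound_at_infinity[OF r] by blast
  \<comment> \<open>Reflects the line when \<open>Re \<delta>\<close> is negative, so that the half
    line in question is always a positive one.\<close>
  define s :: real where "s = (if Re \<delta> \<ge> 0 then 1 else -1)"
  have s: "s \<noteq> 0" "\<bar>s\<bar> = 1" "s * Re \<delta> \<ge> 0" by (auto simp: s_def)
  have [measurable]: "f \<in> borel_measurable borel" using f by (simp add: L2_real_def)
  have L: "L2_real (\<lambda>u. f (0 + s * u))" by (rule L2_affine[OF f s(1)])
  have "AE u in lborel. f (0 + s * u) = poly r (of_real (0 + s * u)) * exp (- \<eta> * (of_real (0 + s * u))\<^sup>2 + \<delta> * of_real (0 + s * u))"
    by (rule AE_borel_affine[OF s(1) _ eq]) measurable
  then have low: "AE u in lborel. u \<ge> R \<longrightarrow> (norm (f (0 + s * u)))\<^sup>2 \<ge> d\<^sup>2"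
  proof eventually_elim
    case (elim u)
    show ?case
    proof
      assume u: "u \<ge> R"
      have 1: "norm (poly r (of_real (s * u))) \<ge> d"
        by (rule d(3)) (use u d(2) s in \<open>simp add: norm_mult\<close>)
      have "Re (- \<eta> * (of_real (s * u))\<^sup>2 + \<delta> * of_real (s * u)) = - Re \<eta> * (s * u)\<^sup>2 + (s * Re \<delta>) * u"
        by (simp flip: of_real_power of_real_mult)
      also have "\<dots> \<ge> 0"
      proof (rule add_nonneg_nonneg)
        show "0 \<le> - Re \<eta> * (s * u)\<^sup>2" using n by (intro mult_nonneg_nonneg) auto
        show "0 \<le> s * Re \<delta> * u" using mult_nonneg_nonneg[OF s(3), of u] u d(2) by linarith
      qed
      finally have 2: "norm (exp (- \<eta> * (of_real (s * u))\<^sup>2 + \<delta> * of_real (s * u))) \<ge> 1"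
        by (simp only: norm_exp_eq_Re one_le_exp_iff)
      have "norm (f (s * u)) = norm (poly r (of_real (s * u))) * norm (exp (- \<eta> * (of_real (s * u))\<^sup>2 + \<delta> * of_real (s * u)))"
        using elim by (simp only: add_0 norm_mult)
      also have "\<dots> \<ge> d * 1" by (intro mult_mono 1 2) (use d in auto)
      finally show "(norm (f (0 + s * u)))\<^sup>2 \<ge> d\<^sup>2" using d by (simp add: power_mono)
    qed
  qed
  show False
    by (rule integrable_not_bounded_below_halfline[OF _ _ _ low]) (use L d in \<open>auto simp: L2_real_def\<close>)
qed

text \<open>A polynomial times a Gaussian with the same transform is constructed, and injectivity
  identifies it with \<open>f\<close> times the weight \<open>exp (- u\<^sup>2 / 2)\<close>.
  Removing that weight lowers the quadratic coefficient from \<open>\<gamma>\<close> to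
  \<open>\<gamma> - 1/2\<close>, so positivity of its real part has to be established anew.\<close>

lemma bargmann_poly_gauss_imp:
  assumes f: "L2_real f" and P: "P \<noteq> 0" and eq: "\<And>z. bargmann f 1 z = poly P z * exp (\<alpha> * z\<^sup>2 + \<beta> * z)"
  obtains r \<eta> \<delta> where "Re \<eta> > 0"
    "AE u in lborel. f u = poly r (of_real u) * exp (- \<eta> * (of_real u)\<^sup>2 + \<delta> * of_real u)"
proof -
  have \<alpha>: "Re \<alpha> > 0" by (rule bargmann_exponent[OF f P eq])
  then have \<alpha>0: "\<alpha> \<noteq> 0" by auto
  \<comment> \<open>The Gaussian with coefficient \<open>\<gamma>\<close> has transform
    \<open>exp (z\<^sup>2 / (4 * \<gamma>))\<close> up to a constant; matching this with
    \<open>\<alpha> * z\<^sup>2\<close> fixes \<open>\<gamma>\<close>.\<close>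
  define \<gamma> where "\<gamma> = 1 / (4 * \<alpha>)"
  have \<gamma>: "Re \<gamma> > 0" using \<alpha> \<alpha>0 by (simp add: \<gamma>_def Re_divide complex_neq_0 power2_eq_square)
  have \<gamma>4: "w / (4 * \<gamma>) = \<alpha> * w" for w using \<alpha>0 by (simp add: \<gamma>_def)
  \<comment> \<open>Completes the square: \<open>\<alpha> * z\<^sup>2 + \<beta> * z\<close> is
    \<open>\<alpha> * (z + \<delta>)\<^sup>2\<close> minus a constant. The shift moves into the
    argument of \<open>P\<close> and returns as the linear term \<open>\<delta> * t\<close> in the
    exponent of the Gaussian.\<close>
  define \<delta> where "\<delta> = \<beta> / (2 * \<alpha>)"
  obtain r where r: "\<And>z. (LINT t|lborel. poly r (of_real t) * exp (- \<gamma> * (of_real t)\<^sup>2 + z * of_real t)) =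
     poly (smult (exp (- \<beta>\<^sup>2 / (4 * \<alpha>))) (pcompose P [:- \<delta>, 1:])) z * exp (z\<^sup>2 / (4 * \<gamma>))"
    using poly_gauss_surj[OF \<gamma>] by blast
  have r': "(LINT t|lborel. poly r (of_real t) * exp (- \<gamma> * (of_real t)\<^sup>2 + (\<delta> + z) * of_real t)) = bargmann f 1 z" for z
  proof -
    have "\<alpha> * (z + \<delta>)\<^sup>2 + - \<beta>\<^sup>2 / (4 * \<alpha>) = \<alpha> * z\<^sup>2 + \<beta> * z"
      using \<alpha>0 by (simp add: \<delta>_def power2_eq_square field_simps)
    then have "exp (\<alpha> * z\<^sup>2 + \<beta> * z) = exp (\<alpha> * (z + \<delta>)\<^sup>2) * exp (- \<beta>\<^sup>2 / (4 * \<alpha>))"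
      by (simp only: exp_add[symmetric])
    then show ?thesis unfolding add.commute[of \<delta> z] r eq \<gamma>4 by (simp add: poly_pcompose mult_ac)
  qed
  let ?e = "\<lambda>z u. poly 1 (of_real u) * exp (- (1/2) * (complex_of_real u)\<^sup>2 + z * of_real u)"
  let ?q = "\<lambda>z t. poly r (of_real t) * exp (- \<gamma> * (complex_of_real t)\<^sup>2 + (\<delta> + z) * of_real t)"
  have ie: "integrable lborel (\<lambda>u. f u * ?e z u)" for z by (rule bargmann_integrable[OF f])
  have iq: "integrable lborel (?q z)" for z by (rule poly_gauss_integrable[OF \<gamma>])
  have "AE u in lborel. f u * ?e 0 u - ?q 0 u = 0"
  proof (rule Fourier_injective)
    show "integrable lborel (\<lambda>u. f u * ?e 0 u - ?q 0 u)"
      by (intro Bochner_Integration.integrable_diff ie iq)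
    fix y
    have "(LINT u|lborel. (f u * ?e 0 u - ?q 0 u) * iexp (y * u)) = (LINT u|lborel. f u * ?e (0 + \<i> * of_real y) u - ?q (0 + \<i> * of_real y) u)"
      unfolding add.assoc[symmetric] exp_quadratic_split by (simp only: add_0_right left_diff_distrib mult.assoc)
    also have "\<dots> = bargmann f 1 (0 + \<i> * of_real y) - (LINT u|lborel. ?q (0 + \<i> * of_real y) u)"
      unfolding bargmann_def by (rule Bochner_Integration.integral_diff[OF ie iq])
    also have "\<dots> = 0" unfolding r' by simp
    finally show "(LINT u|lborel. (f u * ?e 0 u - ?q 0 u) * iexp (y * u)) = 0" .
  qed
  then have ae: "AE u in lborel. f u = poly r (of_real u) * exp (- (\<gamma> - 1/2) * (of_real u)\<^sup>2 + \<delta> * of_real u)"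
  proof eventually_elim
    case (elim u)
    let ?c = "exp ((1/2) * (complex_of_real u)\<^sup>2)"
    have "f u = (f u * ?e 0 u) * ?c" by (simp add: mult.assoc exp_add[symmetric])
    also have "f u * ?e 0 u = ?q 0 u" using elim by simp
    also have "?q 0 u * ?c = poly r (of_real u) * exp (- (\<gamma> - 1/2) * (of_real u)\<^sup>2 + \<delta> * of_real u)"
      unfolding mult.assoc exp_add[symmetric] by (simp add: algebra_simps)
    finally show ?case .
  qed
  have "r \<noteq> 0"
  proof
    assume "r = 0"
    then have "bargmann f 1 z = 0" for z using r'[of z] by simp
    then have "poly P z = 0" for z using eq[of z] by simp
    then show False using P poly_eq_poly_eq_iff[of P 0] by (simp add: fun_eq_iff)
  qed
  then have "Re (\<gamma> - 1/2) > 0" by (rule poly_gauss_L2_exponent[OF f _ ae])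
  then show ?thesis using ae by (rule that)
qed

text \<open>Conjugation is antiholomorphic, so the factor \<open>cnj (f (x - t / 2))\<close> cannot
  be continued as it stands. For a polynomial times a Gaussian it equals the expression with
  conjugated coefficients at real arguments, and that expression is holomorphic in a complex line
  parameter. The integral over \<open>t\<close> still converges for complex parameters, since they
  leave the quadratic decay in \<open>t\<close> untouched.\<close>

lemma unit_wigner_poly_gauss_entire_on_lines:
  assumes f: "L2_real f" and \<eta>: "Re \<eta> > 0"
    and ae: "AE u in lborel. f u = poly r (of_real u) * exp (- \<eta> * (of_real u)\<^sup>2 + \<delta> * of_real u)"
  obtains V where "V holomorphic_on UNIV" "\<And>s. unit_wigner f (x + s * a) (p + s * b) = V (of_real s)"
proof -
  define rc where "rc = map_poly cnj r"
  define X where "X s = of_real x + s * of_real a" for s :: complex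
  define Q where "Q s = of_real p + s * of_real b" for s :: complex
  define e where "e s t = - \<eta> * (X s + of_real t / 2)\<^sup>2 + \<delta> * (X s + of_real t / 2)
     + (- cnj \<eta> * (X s - of_real t / 2)\<^sup>2 + cnj \<delta> * (X s - of_real t / 2)) - \<i> * (Q s * of_real t)" for s and t :: real
  define k where "k s t = poly r (X s + of_real t / 2) * poly rc (X s - of_real t / 2) * exp (e s t)" for s and t :: real
  have [measurable]: "f \<in> borel_measurable borel" using f by (simp add: L2_real_def)
  have km: "k s \<in> borel_measurable lborel" for s
    unfolding k_def[abs_def] e_def by measurable
  have wk: "unit_wigner f (x + s * a) (p + s * b) = (LINT t|lborel. k (of_real s) t)" for s :: real
    unfolding unit_wigner_def
  proof (rule integral_cong_AE)
    let ?x = "x + s * a"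
    have 1: "AE t in lborel. f (?x + 1/2 * t) = poly r (of_real (?x + 1/2 * t)) * exp (- \<eta> * (of_real (?x + 1/2 * t))\<^sup>2 + \<delta> * of_real (?x + 1/2 * t))"
      by (rule AE_borel_affine[OF _ _ ae]) (simp, measurable)
    have 2: "AE t in lborel. f (?x + (-1/2) * t) = poly r (of_real (?x + (-1/2) * t)) * exp (- \<eta> * (of_real (?x + (-1/2) * t))\<^sup>2 + \<delta> * of_real (?x + (-1/2) * t))"
      by (rule AE_borel_affine[OF _ _ ae]) (simp, measurable)
    show "AE t in lborel. f (?x + t / 2) * cnj (f (?x - t / 2)) * exp (- (\<i> * of_real ((p + s * b) * t))) = k (of_real s) t"
      using 1 2
    proof eventually_elim
      case (elim t)
      let ?u = "?x + t / 2" and ?v = "?x - t / 2"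
      have u: "X (of_real s) + of_real t / 2 = of_real ?u" "X (of_real s) - of_real t / 2 = of_real ?v"
        by (simp_all add: X_def)
      have fu: "f ?u = poly r (of_real ?u) * exp (- \<eta> * (of_real ?u)\<^sup>2 + \<delta> * of_real ?u)"
        using elim(1) by simp
      have fv: "f ?v = poly r (of_real ?v) * exp (- \<eta> * (of_real ?v)\<^sup>2 + \<delta> * of_real ?v)"
        using elim(2) by simp
      have cfv: "cnj (f ?v) = poly rc (of_real ?v) * exp (- cnj \<eta> * (of_real ?v)\<^sup>2 + cnj \<delta> * of_real ?v)"
        unfolding fv rc_def
        by (simp only: complex_cnj_mult poly_cnj exp_cnj complex_cnj_add complex_cnj_minus complex_cnj_power complex_cnj_complex_of_real)
      have ex: "exp (A + B - C) = exp A * exp B * exp (- C)" for A B C :: complex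
        by (simp flip: exp_add)
      have mult_arrange: "pr * E1 * (pc * E2) * E3 = pr * pc * (E1 * E2 * E3)" for pr pc E1 E2 E3 :: complex
        by (simp only: mult_ac)
      have Qs: "Q (of_real s) * of_real t = of_real ((p + s * b) * t)" by (simp add: Q_def)
      show ?case
        unfolding k_def e_def u ex Qs cfv fu
        by (rule mult_arrange)
    qed
  qed (use km in measurable)
  have "(\<lambda>s. LINT t|lborel. k s t) holomorphic_on UNIV"
    unfolding holomorphic_on_open[OF open_UNIV]
  proof
    fix s0 :: complex
    obtain C1 d1 where C1: "C1 \<ge> 0" "d1 \<ge> 0" "\<And>z. norm (poly r z) \<le> C1 * exp (d1 * norm z)"
      using norm_poly_le_exp[of r] by auto
    obtain C2 d2 where C2: "C2 \<ge> 0" "d2 \<ge> 0" "\<And>z. norm (poly rc z) \<le> C2 * exp (d2 * norm z)"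
      using norm_poly_le_exp[of rc] by auto
    \<comment> \<open>On the unit disc about \<open>s0\<close>, \<open>M\<close> and
      \<open>M'\<close> bound the complexified position and momentum, \<open>L\<close> bounds the
      coefficient of \<open>t\<close> in the exponent, and \<open>L'\<close> its part free of
      \<open>t\<close>.\<close>
    define S where "S = norm s0 + 1"
    define M where "M = \<bar>x\<bar> + S * \<bar>a\<bar>"
    define M' where "M' = \<bar>p\<bar> + S * \<bar>b\<bar>"
    define L where "L = 2 * norm \<eta> * M + norm \<delta> + M'"
    define L' where "L' = 2 * norm \<eta> * M\<^sup>2 + 2 * norm \<delta> * M"
    define D where "D t = C1 * C2 * exp ((d1 + d2) * M + L') * exp ((d1 + d2 + L) * \<bar>t\<bar> - (Re \<eta> / 2) * t\<^sup>2)" for t :: real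
    have iD: "integrable lborel D"
      unfolding D_def[abs_def] by (intro integrable_mult_right gaussian_integrable) (use \<eta> in simp)
    have kD: "norm (k s t) \<le> D t" if s: "s \<in> ball s0 1" for s t
    proof -
      have ns: "norm s \<le> S"
        using s norm_triangle_ineq2[of s s0] by (simp add: S_def dist_norm norm_minus_commute)
      have nX: "norm (X s) \<le> M"
        unfolding X_def M_def
        by (rule order_trans[OF norm_triangle_ineq]) (use ns in \<open>simp add: norm_mult mult_right_mono\<close>)
      have nQ: "norm (Q s) \<le> M'"
        unfolding Q_def M'_def
        by (rule order_trans[OF norm_triangle_ineq]) (use ns in \<open>simp add: norm_mult mult_right_mono\<close>)
      have M0: "M \<ge> 0" using nX norm_ge_zero order_trans by blast
      have nu: "norm (X s + of_real t / 2) \<le> M + \<bar>t\<bar>"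
        by (rule order_trans[OF norm_triangle_ineq]) (use nX in simp)
      have nv: "norm (X s - of_real t / 2) \<le> M + \<bar>t\<bar>"
        by (rule order_trans[OF norm_triangle_ineq4]) (use nX in simp)
      have p1: "norm (poly r (X s + of_real t / 2)) \<le> C1 * exp (d1 * (M + \<bar>t\<bar>))"
        by (rule order_trans[OF C1(3)]) (use nu C1 in \<open>auto intro!: mult_left_mono\<close>)
      have p2: "norm (poly rc (X s - of_real t / 2)) \<le> C2 * exp (d2 * (M + \<bar>t\<bar>))"
        by (rule order_trans[OF C2(3)]) (use nv C2 in \<open>auto intro!: mult_left_mono\<close>)
      \<comment> \<open>Sorted by powers of \<open>t\<close>: the quadratic coefficient is
        \<open>- (Re \<eta> / 2)\<close>, real and independent of \<open>s\<close>. The parameter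
        enters only the linear and constant terms, so the Gaussian decay is locally uniform in
        \<open>s\<close>.\<close>
      have e_eq: "e s t = of_real (- (Re \<eta> / 2) * t\<^sup>2) + of_real t * ((cnj \<eta> - \<eta>) * X s + (\<delta> - cnj \<delta>) / 2 - \<i> * Q s)
        + (- (\<eta> + cnj \<eta>) * (X s)\<^sup>2 + (\<delta> + cnj \<delta>) * X s)"
      proof -
        have "\<eta> + cnj \<eta> = of_real (2 * Re \<eta>)" by (rule complex_add_cnj)
        then have eq: "of_real (- (Re \<eta> / 2) * t\<^sup>2) = - (\<eta> + cnj \<eta>) * (of_real t)\<^sup>2 / 4" by simp
        show ?thesis unfolding eq e_def by (simp add: power2_eq_square field_simps)
      qed
      have A: "norm (of_real t * ((cnj \<eta> - \<eta>) * X s + (\<delta> - cnj \<delta>) / 2 - \<i> * Q s)) \<le> \<bar>t\<bar> * L"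
      proof -
        have "norm ((cnj \<eta> - \<eta>) * X s) \<le> (2 * norm \<eta>) * M"
          unfolding norm_mult using norm_triangle_ineq4[of "cnj \<eta>" \<eta>] nX by (intro mult_mono) auto
        moreover have "norm ((\<delta> - cnj \<delta>) / 2) \<le> norm \<delta>"
          using norm_triangle_ineq4[of \<delta> "cnj \<delta>"] by (simp add: norm_divide)
        moreover have "norm (\<i> * Q s) \<le> M'" using nQ by (simp add: norm_mult)
        moreover have "norm ((cnj \<eta> - \<eta>) * X s + (\<delta> - cnj \<delta>) / 2 - \<i> * Q s) \<le>
          norm ((cnj \<eta> - \<eta>) * X s) + norm ((\<delta> - cnj \<delta>) / 2) + norm (\<i> * Q s)"
          by (intro order_trans[OF norm_triangle_ineq4] add_right_mono norm_triangle_ineq)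
        ultimately have "norm ((cnj \<eta> - \<eta>) * X s + (\<delta> - cnj \<delta>) / 2 - \<i> * Q s) \<le> L"
          unfolding L_def by linarith
        then show ?thesis unfolding norm_mult[of "of_real t"] norm_of_real by (intro mult_left_mono) auto
      qed
      have B: "norm (- (\<eta> + cnj \<eta>) * (X s)\<^sup>2 + (\<delta> + cnj \<delta>) * X s) \<le> L'"
      proof -
        have "norm (- (\<eta> + cnj \<eta>) * (X s)\<^sup>2) \<le> (2 * norm \<eta>) * M\<^sup>2"
          unfolding norm_mult norm_power norm_minus_cancel
          using norm_triangle_ineq[of \<eta> "cnj \<eta>"] nX by (intro mult_mono power_mono) auto
        moreover have "norm ((\<delta> + cnj \<delta>) * X s) \<le> (2 * norm \<delta>) * M"
          unfolding norm_mult using norm_triangle_ineq[of \<delta> "cnj \<delta>"] nX by (intro mult_mono) auto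
        ultimately show ?thesis
          using norm_triangle_ineq[of "- (\<eta> + cnj \<eta>) * (X s)\<^sup>2" "(\<delta> + cnj \<delta>) * X s"] unfolding L'_def by linarith
      qed
      have "Re (e s t) \<le> - (Re \<eta> / 2) * t\<^sup>2 + \<bar>t\<bar> * L + L'"
        unfolding e_eq plus_complex.sel(1) Re_complex_of_real
        by (intro add_mono order_refl order_trans[OF complex_Re_le_cmod A] order_trans[OF complex_Re_le_cmod B, unfolded plus_complex.sel(1)])
      then have p3: "norm (exp (e s t)) \<le> exp (- (Re \<eta> / 2) * t\<^sup>2 + \<bar>t\<bar> * L + L')"
        by (simp only: norm_exp_eq_Re exp_le_cancel_iff)
      have "norm (k s t) \<le> (C1 * exp (d1 * (M + \<bar>t\<bar>))) * (C2 * exp (d2 * (M + \<bar>t\<bar>))) * exp (- (Re \<eta> / 2) * t\<^sup>2 + \<bar>t\<bar> * L + L')"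
        unfolding k_def norm_mult by (intro mult_mono p1 p2 p3) (use C1 C2 in auto)
      also have "\<dots> = C1 * C2 * (exp (d1 * (M + \<bar>t\<bar>)) * exp (d2 * (M + \<bar>t\<bar>)) * exp (- (Re \<eta> / 2) * t\<^sup>2 + \<bar>t\<bar> * L + L'))"
        by (simp only: mult_ac)
      also have "exp (d1 * (M + \<bar>t\<bar>)) * exp (d2 * (M + \<bar>t\<bar>)) * exp (- (Re \<eta> / 2) * t\<^sup>2 + \<bar>t\<bar> * L + L') =
        exp ((d1 + d2) * M + L') * exp ((d1 + d2 + L) * \<bar>t\<bar> - (Re \<eta> / 2) * t\<^sup>2)"
        unfolding exp_add[symmetric] by (rule arg_cong[where f=exp]) (simp add: algebra_simps)
      finally show ?thesis unfolding D_def by (simp only: mult.assoc)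
    qed
    have hol: "(\<lambda>s. k s t) holomorphic_on UNIV" for t
      unfolding k_def e_def X_def Q_def by (intro holomorphic_intros holomorphic_on_compose[where g="poly _", unfolded o_def])
    have "((\<lambda>s. LINT t|lborel. k s t) has_field_derivative (LINT t|lborel. deriv (\<lambda>s. k s t) s0)) (at s0)"
      by (rule has_field_derivative_integral[OF zero_less_one km _ kD iD])
         (use holomorphic_derivI[OF hol open_UNIV] in auto)
    then show "\<exists>f'. ((\<lambda>s. LINT t|lborel. k s t) has_field_derivative f') (at s0)" by blast
  qed
  then show ?thesis using wk by (rule that)
qed

text \<open>Boundedness enters twice: it yields the explicit form of \<open>f\<close>, and it is
  what the resulting line of zeros contradicts.\<close>

lemma unit_wigner_zero_segment_unbounded:
  assumes f: "L2_real f" and zero: "\<And>s. s \<in> {0..1} \<Longrightarrow> unit_wigner f (x + s * a) (p + s * b) = 0"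
    and ab: "(a, b) \<noteq> (0, 0)"
  shows "\<not> bounded {z. unit_wigner f (fst z) (snd z) = 0}"
proof
  assume bd: "bounded {z. unit_wigner f (fst z) (snd z) = 0}"
  obtain R where R: "\<And>z. norm z \<ge> R \<Longrightarrow> bargmann f 1 z \<noteq> 0"
    using bargmann_nonzero[OF f bd] by blast
  have hol: "bargmann f 1 holomorphic_on UNIV"
    using bargmann_has_field_derivative[OF f] unfolding holomorphic_on_open[OF open_UNIV] by blast
  obtain B where B: "\<And>z. norm (bargmann f 1 z) \<le> B * exp ((Re z)\<^sup>2 / 2)" using norm_bargmann_le[OF f] by blast
  have growth: "norm (bargmann f 1 z) \<le> \<bar>B\<bar> * exp ((norm z)\<^sup>2)" for z
  proof -
    have "(Re z)\<^sup>2 \<le> (norm z)\<^sup>2" by (simp add: cmod_power2)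
    then have "(Re z)\<^sup>2 / 2 \<le> (norm z)\<^sup>2" using zero_le_power2[of "Re z"] by linarith
    then have "\<bar>B\<bar> * exp ((Re z)\<^sup>2 / 2) \<le> \<bar>B\<bar> * exp ((norm z)\<^sup>2)" by (intro mult_left_mono) auto
    moreover have "B * exp ((Re z)\<^sup>2 / 2) \<le> \<bar>B\<bar> * exp ((Re z)\<^sup>2 / 2)" by (intro mult_right_mono) auto
    ultimately show ?thesis using B[of z] by linarith
  qed
  obtain P \<alpha> \<beta> where P: "P \<noteq> 0" "\<And>z. bargmann f 1 z = poly P z * exp (\<alpha> * z\<^sup>2 + \<beta> * z)"
    using entire_order2_finite_zeros[OF hol R growth] by blast
  obtain r \<eta> \<delta> where r: "Re \<eta> > 0"
    "AE u in lborel. f u = poly r (of_real u) * exp (- \<eta> * (of_real u)\<^sup>2 + \<delta> * of_real u)"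
    using bargmann_poly_gauss_imp[OF f P] by blast
  obtain V where V: "V holomorphic_on UNIV" "\<And>s. unit_wigner f (x + s * a) (p + s * b) = V (of_real s)"
    using unit_wigner_poly_gauss_entire_on_lines[OF f r] by blast
  let ?U = "complex_of_real ` {0..1}"
  have "V (of_real s) = 0" for s
  proof (rule analytic_continuation[OF V(1) open_UNIV connected_UNIV])
    show "(0::complex) islimpt ?U"
    proof (rule connected_imp_perfect)
      show "connected ?U" by (intro connected_continuous_image continuous_intros) auto
      show "0 \<in> ?U" by force
      have "complex_of_real 0 \<in> ?U" "complex_of_real 1 \<in> ?U" by (intro imageI; simp)+
      then show "?U \<noteq> {y}" for y by (metis of_real_eq_iff singletonD zero_neq_one)
    qed
    show "V z = 0" if "z \<in> ?U" for z using that zero V(2) by auto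
  qed auto
  then have all: "unit_wigner f (x + s * a) (p + s * b) = 0" for s using V(2) by simp
  obtain K where K: "\<And>z. unit_wigner f (fst z) (snd z) = 0 \<Longrightarrow> norm z \<le> K"
    using bd unfolding bounded_iff by blast
  have n: "norm (a, b) > 0" using ab by (simp add: zero_prod_def)
  \<comment> \<open>At this parameter the displacement from \<open>(x, p)\<close> has length
    \<open>\<bar>K\<bar> + norm (x, p) + 1\<close>, which puts the point outside the disc of radius
    \<open>K\<close>.\<close>
  define s where "s = (\<bar>K\<bar> + norm (x, p) + 1) / norm (a, b)"
  have s0: "s \<ge> 0" unfolding s_def using n by (intro divide_nonneg_nonneg add_nonneg_nonneg) auto
  have "norm (s *\<^sub>R (a, b)) = \<bar>K\<bar> + norm (x, p) + 1"
    unfolding norm_scaleR using s0 n by (simp only: abs_of_nonneg) (simp add: s_def)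
  moreover have "norm ((x, p) + s *\<^sub>R (a, b)) \<le> K"
    using K[of "(x + s * a, p + s * b)"] all[of s] by simp
  moreover have "norm (s *\<^sub>R (a, b)) \<le> norm ((x, p) + s *\<^sub>R (a, b)) + norm (x, p)"
    using norm_triangle_ineq4[of "(x, p) + s *\<^sub>R (a, b)" "(x, p)"] by (simp only: add_diff_cancel_left')
  ultimately show False by linarith
qed

theorem theorem5:
  fixes hb :: real and f :: "real \<Rightarrow> complex"
  assumes "hb > 0"
    and "L2_real f"
    and "bounded (nodal_set hb f)"
  shows "\<not> (\<exists>a b. a \<noteq> b \<and> closed_segment a b \<subseteq> nodal_set hb f)"
proof
  assume "\<exists>a b. a \<noteq> b \<and> closed_segment a b \<subseteq> nodal_set hb f"
  then obtain a b where ab: "a \<noteq> b" "closed_segment a b \<subseteq> nodal_set hb f" by blast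
  have nodal: "z \<in> nodal_set hb f \<longleftrightarrow> unit_wigner f (fst z) (snd z / hb) = 0" for z
    using \<open>hb > 0\<close> by (simp add: nodal_set_def wigner_eq_unit_wigner)
  \<comment> \<open>Dividing the momentum by \<open>hb\<close> is a linear map, so the zero set of
    \<open>unit_wigner\<close> inherits boundedness from the nodal set, and segments go to
    segments.\<close>
  have "{z. unit_wigner f (fst z) (snd z) = 0} \<subseteq> (\<lambda>z. (fst z, snd z / hb)) ` nodal_set hb f"
  proof
    fix z assume "z \<in> {z. unit_wigner f (fst z) (snd z) = 0}"
    then show "z \<in> (\<lambda>z. (fst z, snd z / hb)) ` nodal_set hb f"
      using \<open>hb > 0\<close> by (intro image_eqI[of _ _ "(fst z, hb * snd z)"]) (auto simp: nodal)
  qed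
  moreover have "bounded ((\<lambda>z. (fst z, snd z / hb)) ` nodal_set hb f)"
    by (intro bounded_linear_image[OF assms(3)] bounded_linear_Pair bounded_linear_fst
          bounded_linear_compose[OF bounded_linear_divide bounded_linear_snd])
  ultimately have "bounded {z. unit_wigner f (fst z) (snd z) = 0}" by (rule bounded_subset[rotated])
  moreover have "\<not> bounded {z. unit_wigner f (fst z) (snd z) = 0}"
  proof (rule unit_wigner_zero_segment_unbounded[OF assms(2)])
    show "(fst b - fst a, (snd b - snd a) / hb) \<noteq> (0, 0)"
      using ab(1) \<open>hb > 0\<close> by (auto simp: prod_eq_iff)
    fix s :: real assume s: "s \<in> {0..1}"
    have "(1 - s) *\<^sub>R a + s *\<^sub>R b \<in> closed_segment a b"
      using s by (auto simp: closed_segment_def)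
    with ab(2) have "(1 - s) *\<^sub>R a + s *\<^sub>R b \<in> nodal_set hb f" by blast
    then have "unit_wigner f ((1 - s) * fst a + s * fst b) (((1 - s) * snd a + s * snd b) / hb) = 0"
      unfolding nodal by simp
    also have "(1 - s) * fst a + s * fst b = fst a + s * (fst b - fst a)" by (simp add: algebra_simps)
    also have "((1 - s) * snd a + s * snd b) / hb = snd a / hb + s * ((snd b - snd a) / hb)"
      by (simp add: algebra_simps add_divide_distrib diff_divide_distrib)
    finally show "unit_wigner f (fst a + s * (fst b - fst a)) (snd a / hb + s * ((snd b - snd a) / hb)) = 0" .
  qed
  ultimately show False by blast
qed

end
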